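(* Let $V$ be a complex vector space of dimension $n>1$ and let $\rho$ be the representation of $\mathfrak{sl}(V)$ on the space of symmetric forms $S^2(V)$ corresponding to the congruence action. Then the Jordan--Kronecker invariants of $\rho$ are: - $\frac{n(n-1)}{2}$ horizontal indices $\mathrm{h}_i=2$; - one vertical index $\mathrm{v}_1=n$ (and there are no other blocks).
   Context: Everything is over $\mathbb{C}$ and finite-dimensional. Pencils. For linear maps $A,B:U\to V$ there are bases of $U$ and $V$ (Kronecker's theorem) in which all matrices $A+\lambda B$ are simultaneously block-diagonal, each pair of diagonal blocks $(A_i,B_i)$ being one of: (i) a $k\times k$ Jordan block with eigenvalue $\lambda_0\in\mathbb{C}$: $A_i=J_k(\lambda_0)$ (the upper triangular Jordan block), $B_i=I_k$; (ii) a $k\times k$ Jordan block with eigenvalue $\infty$: $A_i=I_k$, $B_i=J_k(0)$; (iii) a horizontal Kronecker block of size $(h-1)\times h$, $h\ge 1$: $A_i=(0\,|\,I_{h-1})$, $B_i=(I_{h-1}\,|\,0)$; (iv) a vertical Kronecker block of size $v\times(v-1)$, $v\ge1$: the transposes of the matrices in (iii) with $h=v$. A $0\times 1$ horizontal block ($h=1$) is a zero column and a $1\times 0$ vertical block ($v=1$) is a zero row. The blocks are unique up to permutation. The numbers $h$ (widths of horizontal blocks) are the horizontal indices, the numbers $v$ (heights of vertical blocks) are the vertical indices. Representations. For a representation $\rho:\mathfrak{g}\to\mathfrak{gl}(W)$ and $x\in W$ put $R_x:\mathfrak{g}\to W$, $R_x(\xi)=\rho(\xi)x$. The algebraic type of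 the pencil $R_a+\lambda R_b=R_{a+\lambda b}$ is the collection: number of distinct eigenvalues of Jordan blocks, number and sizes of the Jordan blocks for each eigenvalue, horizontal and vertical indices (with multiplicity). The Jordan--Kronecker (JK) invariants of $\rho$ are the algebraic type of $R_{a+\lambda b}$ for a generic pair $(a,b)\in W\times W$ (i.e. for all pairs in some non-empty Zariski open subset). Congruence action. In a fixed basis of $V$, the group $\mathrm{GL}(V)$ acts on bilinear forms (square matrices $Q$) by $(P,Q)\mapsto PQP^T$; the corresponding Lie algebra representation is $\rho(X)Q=XQ+QX^T$. Here it is restricted to traceless $X\in\mathfrak{sl}(V)$ and symmetric matrices $Q\in S^2(V)$. *)

theory Defs
  imports "HOL-Analysis.Analysis" "Jordan_Normal_Form.Jordan_Normal_Form"
begin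

no_notation Matrix.vec_index (infixl "$" 100)

section \<open>Kronecker canonical form of a pencil\<close>

text \<open>Eigenvalues range over the projective line; \<open>None\<close> stands for the eigenvalue infinity.
  A block \<open>Horizontal h\<close> has size \<open>(h - 1) \<times> h\<close>, a block \<open>Vertical v\<close> has size \<open>v \<times> (v - 1)\<close>.\<close>

datatype kblock = Jordan "complex option" nat | Horizontal nat | Vertical nat

fun valid_block :: "kblock \<Rightarrow> bool" where
  "valid_block (Jordan \<mu> k) \<longleftrightarrow> k \<ge> 1"
| "valid_block (Horizontal h) \<longleftrightarrow> h \<ge> 1"
| "valid_block (Vertical v) \<longleftrightarrow> v \<ge> 1"

definition zero_one_block :: "nat \<Rightarrow> complex mat"  \<comment> \<open>\<open>(0 | I)\<close>\<close>
  where "zero_one_block h = Matrix.mat (h - 1) h (\<lambda>(i, j). if j = i + 1 then 1 else 0)"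

definition one_zero_block :: "nat \<Rightarrow> complex mat"  \<comment> \<open>\<open>(I | 0)\<close>\<close>
  where "one_zero_block h = Matrix.mat (h - 1) h (\<lambda>(i, j). if j = i then 1 else 0)"

text \<open>The two matrices \<open>(A\<^sub>i, B\<^sub>i)\<close> of a block of the pencil \<open>A + \<lambda> B\<close>.\<close>

fun block_A :: "kblock \<Rightarrow> complex mat" where
  "block_A (Jordan (Some \<mu>) k) = jordan_block k \<mu>"
| "block_A (Jordan None k) = 1\<^sub>m k"
| "block_A (Horizontal h) = zero_one_block h"
| "block_A (Vertical v) = transpose_mat (zero_one_block v)"

fun block_B :: "kblock \<Rightarrow> complex mat" where
  "block_B (Jordan (Some \<mu>) k) = 1\<^sub>m k"
| "block_B (Jordan None k) = jordan_block k 0"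
| "block_B (Horizontal h) = one_zero_block h"
| "block_B (Vertical v) = transpose_mat (one_zero_block v)"

text \<open>The algebraic type forgets the values of the eigenvalues: \<open>jordan_sizes\<close> contains, for each
  distinct eigenvalue, the multiset of the sizes of its Jordan blocks. Hence its \<open>size\<close> is the number
  of distinct eigenvalues.\<close>

record algebraic_type =
  jordan_sizes :: "nat multiset multiset"
  horizontal_indices :: "nat multiset"
  vertical_indices :: "nat multiset"

definition type_of_blocks :: "kblock list \<Rightarrow> algebraic_type" where
  "type_of_blocks bs =
    \<lparr> jordan_sizes =
        image_mset (\<lambda>\<mu>. mset [k. Jordan \<nu> k \<leftarrow> bs, \<nu> = \<mu>])
          (mset_set {\<mu>. \<exists>k. Jordan \<mu> k \<in> set bs}),
      horizontal_indices = mset [h. Horizontal h \<leftarrow> bs],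
      vertical_indices = mset [v. Vertical v \<leftarrow> bs] \<rparr>"

text \<open>Vector spaces are subspaces \<open>U\<close> of an ambient type with complex scalar multiplication \<open>s\<close>.\<close>

definition ordered_basis ::
    "(complex \<Rightarrow> 'u::ab_group_add \<Rightarrow> 'u) \<Rightarrow> 'u set \<Rightarrow> 'u list \<Rightarrow> bool" where
  "ordered_basis s U us \<longleftrightarrow>
     distinct us \<and> \<not> module.dependent s (set us) \<and> module.span s (set us) = U"

definition represented_by ::
    "(complex \<Rightarrow> 'v::ab_group_add \<Rightarrow> 'v) \<Rightarrow> 'u list \<Rightarrow> 'v list \<Rightarrow> ('u \<Rightarrow> 'v) \<Rightarrow> complex mat \<Rightarrow> bool"
  where
  "represented_by s us vs f M \<longleftrightarrow>
     M \<in> carrier_mat (length vs) (length us) \<and>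
     (\<forall>j < length us. f (us ! j) = (\<Sum>i < length vs. s (M $$ (i, j)) (vs ! i)))"

text \<open>The algebraic type of the pencil \<open>A + \<lambda> B\<close> of linear maps \<open>U \<rightarrow> V\<close>. It is stated as a relation;
  by Kronecker's theorem every pencil has exactly one algebraic type.\<close>

definition has_algebraic_type ::
    "(complex \<Rightarrow> 'u::ab_group_add \<Rightarrow> 'u) \<Rightarrow> 'u set \<Rightarrow> (complex \<Rightarrow> 'v::ab_group_add \<Rightarrow> 'v) \<Rightarrow> 'v set \<Rightarrow>
     ('u \<Rightarrow> 'v) \<Rightarrow> ('u \<Rightarrow> 'v) \<Rightarrow> algebraic_type \<Rightarrow> bool" where
  "has_algebraic_type sU U sV V A B T \<longleftrightarrow>
     (\<exists>bs us vs. (\<forall>b \<in> set bs. valid_block b) \<and>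
        ordered_basis sU U us \<and> ordered_basis sV V vs \<and>
        represented_by sV us vs A (diag_block_mat (map block_A bs)) \<and>
        represented_by sV us vs B (diag_block_mat (map block_B bs)) \<and>
        type_of_blocks bs = T)"

section \<open>Zariski open sets\<close>

text \<open>Polynomial functions on a (finite-dimensional) space: the algebra generated by the constants
  and the linear functionals.\<close>

inductive polynomial_fun ::
    "(complex \<Rightarrow> 'w::ab_group_add \<Rightarrow> 'w) \<Rightarrow> ('w \<Rightarrow> complex) \<Rightarrow> bool" for s where
  const: "polynomial_fun s (\<lambda>_. c)"
| linear: "Vector_Spaces.linear s (*) \<phi> \<Longrightarrow> polynomial_fun s \<phi>"
| add: "polynomial_fun s f \<Longrightarrow> polynomial_fun s g \<Longrightarrow> polynomial_fun s (\<lambda>x. f x + g x)"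
| mult: "polynomial_fun s f \<Longrightarrow> polynomial_fun s g \<Longrightarrow> polynomial_fun s (\<lambda>x. f x * g x)"

definition zariski_open_in ::
    "(complex \<Rightarrow> 'w::ab_group_add \<Rightarrow> 'w) \<Rightarrow> 'w set \<Rightarrow> 'w set \<Rightarrow> bool" where
  "zariski_open_in s W \<Omega> \<longleftrightarrow>
     (\<exists>F. (\<forall>f \<in> F. polynomial_fun s f) \<and> \<Omega> = {x \<in> W. \<exists>f \<in> F. f x \<noteq> 0})"

section \<open>Jordan--Kronecker invariants\<close>

text \<open>Here \<open>\<rho>\<close> is a representation of the Lie algebra \<open>G\<close> on \<open>W\<close>, so that
  \<open>\<lambda>\<xi>. \<rho> \<xi> a\<close> is the map \<open>R\<^sub>a : G \<rightarrow> W\<close>.\<close>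

definition has_JK_invariants ::
    "(complex \<Rightarrow> 'g::ab_group_add \<Rightarrow> 'g) \<Rightarrow> 'g set \<Rightarrow> (complex \<Rightarrow> 'w::ab_group_add \<Rightarrow> 'w) \<Rightarrow> 'w set \<Rightarrow>
     ('g \<Rightarrow> 'w \<Rightarrow> 'w) \<Rightarrow> algebraic_type \<Rightarrow> bool" where
  "has_JK_invariants sG G sW W \<rho> T \<longleftrightarrow>
     (\<exists>\<Omega>. zariski_open_in (module_prod.scale sW sW) (W \<times> W) \<Omega> \<and> \<Omega> \<noteq> {} \<and>
        (\<forall>(a, b) \<in> \<Omega>. has_algebraic_type sG G sW W (\<lambda>\<xi>. \<rho> \<xi> a) (\<lambda>\<xi>. \<rho> \<xi> b) T))"

section \<open>The congruence action\<close>

definition mat_scale :: "complex \<Rightarrow> complex^'n^'m \<Rightarrow> complex^'n^'m" where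
  "mat_scale c A = (\<chi> i j. c * A $ i $ j)"

definition sl :: "(complex^'n^'n) set" where
  "sl = {X. Determinants.trace X = 0}"

definition symmetric_forms :: "(complex^'n^'n) set" where
  "symmetric_forms = {Q. transpose Q = Q}"

definition congruence_action :: "complex^'n^'n \<Rightarrow> complex^'n^'n \<Rightarrow> complex^'n^'n" where
  "congruence_action X Q = X ** Q + Q ** transpose X"

text \<open>The congruence action is indeed a representation of the Lie algebra \<open>sl\<close> on
  the symmetric forms.\<close>

lemma vector_space_mat_scale: "vector_space (mat_scale :: complex \<Rightarrow> complex^'n^'m \<Rightarrow> _)"
  by unfold_locales (simp_all add: mat_scale_def Finite_Cartesian_Product.vec_eq_iff algebra_simps)

lemma subspace_sl: "module.subspace mat_scale (sl :: (complex^'n^'n) set)"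
proof -
  interpret vector_space "mat_scale :: complex \<Rightarrow> complex^'n^'n \<Rightarrow> _"
    by (rule vector_space_mat_scale)
  show ?thesis
    by (auto simp: subspace_def sl_def Determinants.trace_def mat_scale_def sum.distrib
        simp flip: sum_distrib_left)
qed

lemma sl_bracket_closed: "X ** Y - Y ** X \<in> sl"
  by (simp add: sl_def Determinants.trace_sub Determinants.trace_mul_sym[of X Y])

lemma subspace_symmetric_forms: "module.subspace mat_scale (symmetric_forms :: (complex^'n^'n) set)"
proof -
  interpret vector_space "mat_scale :: complex \<Rightarrow> complex^'n^'n \<Rightarrow> _"
    by (rule vector_space_mat_scale)
  show ?thesis
    by (auto simp: subspace_def symmetric_forms_def transpose_def mat_scale_def Finite_Cartesian_Product.vec_eq_iff)
qed

lemma transpose_add: "transpose (A + B) = transpose A + transpose (B :: complex^'n^'m)"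
  by (simp add: transpose_def Finite_Cartesian_Product.vec_eq_iff)

lemma transpose_diff: "transpose (A - B) = transpose A - transpose (B :: complex^'n^'m)"
  by (simp add: transpose_def Finite_Cartesian_Product.vec_eq_iff)

lemma congruence_action_closed:
  "Q \<in> symmetric_forms \<Longrightarrow> congruence_action X Q \<in> symmetric_forms"
  by (simp add: symmetric_forms_def congruence_action_def transpose_add matrix_transpose_mul
      add.commute)

lemma linear_congruence_action_left:
  "Vector_Spaces.linear mat_scale mat_scale (\<lambda>X. congruence_action X (Q :: complex^'n^'n))"
proof -
  interpret vector_space_pair
    "mat_scale :: complex \<Rightarrow> complex^'n^'n \<Rightarrow> _" "mat_scale :: complex \<Rightarrow> complex^'n^'n \<Rightarrow> _"
    by (intro vector_space_pair.intro vector_space_mat_scale)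
  show ?thesis
    by (simp add: Vector_Spaces.linear_iff vector_space_mat_scale congruence_action_def mat_scale_def
        Finite_Cartesian_Product.vec_eq_iff matrix_matrix_mult_def transpose_def sum.distrib
        sum_distrib_left algebra_simps)
qed

lemma linear_congruence_action_right:
  "Vector_Spaces.linear mat_scale mat_scale (congruence_action (X :: complex^'n^'n))"
proof -
  interpret vector_space_pair
    "mat_scale :: complex \<Rightarrow> complex^'n^'n \<Rightarrow> _" "mat_scale :: complex \<Rightarrow> complex^'n^'n \<Rightarrow> _"
    by (intro vector_space_pair.intro vector_space_mat_scale)
  show ?thesis
    by (simp add: Vector_Spaces.linear_iff vector_space_mat_scale congruence_action_def mat_scale_def
        Finite_Cartesian_Product.vec_eq_iff matrix_matrix_mult_def transpose_def sum.distrib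
        sum_distrib_left algebra_simps)
qed

lemma matrix_distribs:
  fixes A :: "complex^'n^'m" and C :: "complex^'k^'n"
  shows "A ** (C - D) = A ** C - A ** D"
    and "(A + B) ** C = A ** C + B ** C"
    and "(A - B) ** C = A ** C - B ** C"
  by (simp_all add: matrix_matrix_mult_def Finite_Cartesian_Product.vec_eq_iff algebra_simps
      sum.distrib sum_subtractf)

lemma congruence_action_bracket:
  "congruence_action (X ** Y - Y ** X) Q =
     congruence_action X (congruence_action Y Q) - congruence_action Y (congruence_action X Q)"
  by (simp add: congruence_action_def transpose_diff matrix_transpose_mul matrix_mul_assoc
      matrix_add_ldistrib matrix_distribs)

end

(* A generic pair of symmetric forms (a, b) is simultaneously congruent to (I, diag d) with distinct
   d i, because det (t a - b) generically has n simple roots and its eigenvectors are a-orthogonal.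
   Congruence by P together with X \<mapsto> P X P^-1 preserves the algebraic type, so it suffices to
   treat (I, diag d). There the pencil splits: each pair i < j, with E_ij and E_ji in the source and
   E_ij + E_ji in the target, is a horizontal block of width 2, and the traceless diagonal matrices
   form one vertical block of height n, whose bases are the diagonal matrices d^k w with w the
   weights 1 / prod_(j ~= i) (d i - d j) of Lagrange interpolation: they satisfy
   sum_i w i (d i)^k = 0 for k < n - 1. *)

theory Submission
  imports Defs "Subresultants.Subresultant_Gcd" "HOL-Computational_Algebra.Field_as_Ring"
begin

no_notation Matrix.vec_index (infixl "$" 100)

text \<open>The vertical block comes from the trace condition. On all diagonal matrices the pencil
  at (I, diag d) is 2 (I + \<lambda> diag d), which has n Jordan blocks of size 1. The map p
  \<mapsto> diag (w i * p (d i)) identifies polynomials of degree less than n with diagonal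
  matrices, and the weights w are chosen so that the trace becomes the coefficient at n - 1.
  Traceless diagonal matrices are then the polynomials of degree less than n - 1, and the two maps
  become, up to the factor 2, the inclusion and the multiplication by the variable, which form a
  vertical block in monomial bases. For i \<noteq> j both maps send span (E_ij, E_ji) onto the same
  line, and d i \<noteq> d j makes their kernels differ; one vector from each kernel gives the basis
  for the block of width 2. Genericity has to be a polynomial condition on all pairs: det a times a
  determinant that equals the resultant of det (t a - b) and its derivative wherever det a is
  non-zero.\<close>

section \<open>Ordered bases and coordinate matrices\<close>

text \<open>Coefficients are indexed by position, not by vector, so distinctness comes for free: two
  equal entries would admit the relation with coefficients 1 and -1.\<close>

lemma ordered_basisI:
  assumes "vector_space s" and sub: "module.subspace s U" and mem: "set us \<subseteq> U"
    and indep: "\<And>c. (\<Sum>k<length us. s (c k) (us ! k)) = 0 \<Longrightarrow> \<forall>k<length us. c k = 0"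
    and sp: "\<And>x. x \<in> U \<Longrightarrow> \<exists>c. x = (\<Sum>k<length us. s (c k) (us ! k))"
  shows "ordered_basis s U us"
proof -
  interpret vector_space s by fact
  have dist: "distinct us"
  proof (rule ccontr)
    assume "\<not> distinct us"
    then obtain i j where ij: "i < length us" "j < length us" "i \<noteq> j" "us ! i = us ! j"
      by (auto simp: distinct_conv_nth)
    define c where "c k = (if k = i then 1 else if k = j then -1 else (0::complex))" for k
    have "(\<Sum>k<length us. s (c k) (us ! k)) = (\<Sum>k\<in>{i, j}. s (c k) (us ! k))"
      using ij by (intro sum.mono_neutral_right) (auto simp: c_def)
    also have "\<dots> = 0" using ij by (simp add: c_def)
    finally show False using indep[of c] ij by (auto simp: c_def split: if_splits)
  qed
  have reindex: "(\<Sum>v\<in>set us. g v) = (\<Sum>k<length us. g (us ! k))" for g :: "'a \<Rightarrow> 'a"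
    by (rule sum.reindex_bij_betw[OF bij_betw_nth[OF dist], symmetric]) auto
  have "independent (set us)"
  proof
    assume "dependent (set us)"
    then obtain u v where "v \<in> set us" "u v \<noteq> 0" "(\<Sum>v\<in>set us. s (u v) v) = 0"
      by (auto simp: dependent_finite)
    with indep[of "\<lambda>k. u (us ! k)"] show False
      by (auto simp: reindex in_set_conv_nth)
  qed
  moreover have "span (set us) = U"
  proof
    show "span (set us) \<subseteq> U" using mem sub by (rule span_minimal)
    show "U \<subseteq> span (set us)"
      by (auto dest!: sp intro!: span_sum span_scale intro: span_base)
  qed
  ultimately show ?thesis using dist by (simp add: ordered_basis_def)
qed

lemma ordered_basis_image:
  assumes lin: "Vector_Spaces.linear s1 s2 f" and "inj_on f U" "f ` U = V"
    and b: "ordered_basis s1 U us"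
  shows "ordered_basis s2 V (map f us)"
proof -
  interpret f: Vector_Spaces.linear s1 s2 f by fact
  have U: "U = f.vs1.span (set us)" using b by (simp add: ordered_basis_def)
  have "inj_on f (set us)"
    using assms(2) unfolding U by (rule inj_on_subset) (auto intro: f.vs1.span_base)
  moreover have "f.vs2.independent (f ` set us)"
    using b assms(2) unfolding U by (intro f.independent_injective_image) (auto simp: ordered_basis_def)
  ultimately show ?thesis
    using b assms(3) by (auto simp: ordered_basis_def distinct_map f.span_image)
qed

text \<open>A linear relation splits into a part in \<open>U1\<close> and its negative in
  \<open>U2\<close>; both lie in the trivial intersection, so each part is a relation within one
  basis.\<close>

lemma ordered_basis_append:
  assumes "vector_space s"
    and b1: "ordered_basis s U1 us1" and b2: "ordered_basis s U2 us2" and tr: "U1 \<inter> U2 \<subseteq> {0}"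
  shows "ordered_basis s {x + y | x y. x \<in> U1 \<and> y \<in> U2} (us1 @ us2)"
proof -
  interpret vector_space s by fact
  have i1: "independent (set us1)" and i2: "independent (set us2)"
    and s1: "U1 = span (set us1)" and s2: "U2 = span (set us2)"
    using b1 b2 by (auto simp: ordered_basis_def)
  have disj: "set us1 \<inter> set us2 = {}"
  proof (rule ccontr)
    assume "set us1 \<inter> set us2 \<noteq> {}"
    then obtain x where x: "x \<in> set us1" "x \<in> set us2" by auto
    then have "x \<in> U1 \<inter> U2" unfolding s1 s2 by (auto intro: span_base)
    then have "x = 0" using tr by auto
    with x i1 show False using dependent_zero by auto
  qed
  have "independent (set us1 \<union> set us2)"
  proof
    assume "dependent (set us1 \<union> set us2)"
    then obtain u v where u: "v \<in> set us1 \<union> set us2" "u v \<noteq> 0"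
      "(\<Sum>v\<in>set us1 \<union> set us2. s (u v) v) = 0"
      by (subst (asm) dependent_finite) auto
    let ?a = "\<Sum>v\<in>set us1. s (u v) v" and ?b = "\<Sum>v\<in>set us2. s (u v) v"
    have ab: "?a + ?b = 0" using u(3) disj by (simp add: sum.union_disjoint)
    have "?b \<in> U2" unfolding s2 by (intro span_sum span_scale span_base)
    moreover have "?a \<in> U1" unfolding s1 by (intro span_sum span_scale span_base)
    then have "?b \<in> U1" using ab unfolding s1 by (metis add_eq_0_iff span_neg)
    ultimately have "?b = 0" using tr by auto
    with ab have "?a = 0" by simp
    show False
      using u(1,2) independentD[OF i1 finite_set subset_refl \<open>?a = 0\<close>]
        independentD[OF i2 finite_set subset_refl \<open>?b = 0\<close>] by auto
  qed
  then show ?thesis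
    using b1 b2 disj by (auto simp: ordered_basis_def span_Un)
qed

text \<open>The block matrix has exactly the shape of one recursion step of
  \<open>diag_block_mat\<close>.\<close>

lemma represented_by_append:
  fixes f :: "'u \<Rightarrow> 'v::ab_group_add"
  assumes "vector_space s"
    and 1: "represented_by s us1 vs1 f M1" and 2: "represented_by s us2 vs2 f M2"
  shows "represented_by s (us1 @ us2) (vs1 @ vs2) f
    (four_block_mat M1 (0\<^sub>m (dim_row M1) (dim_col M2)) (0\<^sub>m (dim_row M2) (dim_col M1)) M2)"
    (is "represented_by _ _ _ _ ?M")
proof -
  interpret vector_space s by fact
  have c1: "M1 \<in> carrier_mat (length vs1) (length us1)"
    and c2: "M2 \<in> carrier_mat (length vs2) (length us2)"
    using 1 2 by (auto simp: represented_by_def)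
  have "f ((us1 @ us2) ! j) = (\<Sum>i<length vs1 + length vs2. s (?M $$ (i, j)) ((vs1 @ vs2) ! i))"
    if j: "j < length us1 + length us2" for j
  proof -
    have split: "(\<Sum>i<length vs1 + length vs2. g i) =
        (\<Sum>i<length vs1. g i) + (\<Sum>i<length vs2. g (length vs1 + i))" for g :: "nat \<Rightarrow> 'v"
    proof -
      have "(\<Sum>i<m + k. g i) = (\<Sum>i<m. g i) + (\<Sum>i<k. g (m + i))" for m k
        by (induction k) (auto simp: add.assoc)
      then show ?thesis .
    qed
    show ?thesis
    proof (cases "j < length us1")
      case True
      then show ?thesis
        using 1 c1 c2 by (simp add: split nth_append represented_by_def)
    next
      case False
      then show ?thesis
        using 2 c1 c2 j by (simp add: split nth_append represented_by_def)
    qed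
  qed
  then show ?thesis using c1 c2 by (auto simp: represented_by_def)
qed

section \<open>Block decompositions: direct sums and changes of coordinates\<close>

text \<open>This is \<open>has_algebraic_type\<close> with the block list exposed. An algebraic type
  is too coarse for building direct sums: it has forgotten the eigenvalues, so it cannot tell
  whether those of two summands coincide.\<close>

definition has_blocks where
  "has_blocks sU U sV V A B bs \<longleftrightarrow>
     (\<exists>us vs. (\<forall>b \<in> set bs. valid_block b) \<and>
        ordered_basis sU U us \<and> ordered_basis sV V vs \<and>
        represented_by sV us vs A (diag_block_mat (map block_A bs)) \<and>
        represented_by sV us vs B (diag_block_mat (map block_B bs)))"

lemma has_blocks_Cons:
  assumes vs: "vector_space sU" "vector_space sV"
    and b: "has_blocks sU U1 sV V1 A B [b]" and bs: "has_blocks sU U2 sV V2 A B bs"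
    and tr: "U1 \<inter> U2 \<subseteq> {0}" "V1 \<inter> V2 \<subseteq> {0}"
  shows "has_blocks sU {x + y | x y. x \<in> U1 \<and> y \<in> U2} sV {x + y | x y. x \<in> V1 \<and> y \<in> V2} A B (b # bs)"
proof -
  obtain us1 vs1 where 1: "valid_block b" "ordered_basis sU U1 us1" "ordered_basis sV V1 vs1"
    "represented_by sV us1 vs1 A (block_A b)" "represented_by sV us1 vs1 B (block_B b)"
    using b unfolding has_blocks_def by (auto simp del: diag_block_mat.simps)
  obtain us2 vs2 where 2: "\<forall>b \<in> set bs. valid_block b" "ordered_basis sU U2 us2" "ordered_basis sV V2 vs2"
    "represented_by sV us2 vs2 A (diag_block_mat (map block_A bs))"
    "represented_by sV us2 vs2 B (diag_block_mat (map block_B bs))"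
    using bs unfolding has_blocks_def by auto
  show ?thesis
    unfolding has_blocks_def
    by (rule exI[of _ "us1 @ us2"], rule exI[of _ "vs1 @ vs2"])
      (use 1 2 tr vs in \<open>auto simp: Let_def intro!: ordered_basis_append represented_by_append\<close>)
qed

text \<open>By the intertwining equations and linearity of \<open>g\<close>, the image bases have
  the same coordinate matrices for \<open>A'\<close>, \<open>B'\<close> as the original ones for
  \<open>A\<close>, \<open>B\<close>.\<close>

lemma has_blocks_transport:
  assumes f: "Vector_Spaces.linear sU sU f" "inj_on f U" "f ` U = U"
    and g: "Vector_Spaces.linear sV sV g" "inj_on g V" "g ` V = V"
    and A: "\<And>x. A' (f x) = g (A x)" and B: "\<And>x. B' (f x) = g (B x)"
    and bs: "has_blocks sU U sV V A B bs"
  shows "has_blocks sU U sV V A' B' bs"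
proof -
  interpret g: Vector_Spaces.linear sV sV g by fact
  have rep: "represented_by sV (map f us) (map g vs) C' M"
    if "represented_by sV us vs C M" "\<And>x. C' (f x) = g (C x)" for us vs C C' M
    using that by (auto simp: represented_by_def g.sum g.scale intro!: sum.cong)
  from bs obtain us vs where "\<forall>b \<in> set bs. valid_block b"
    "ordered_basis sU U us" "ordered_basis sV V vs"
    "represented_by sV us vs A (diag_block_mat (map block_A bs))"
    "represented_by sV us vs B (diag_block_mat (map block_B bs))"
    unfolding has_blocks_def by auto
  then show ?thesis
    unfolding has_blocks_def using ordered_basis_image[OF f] ordered_basis_image[OF g] rep A B
    by blast
qed

lemma has_blocks_singletonI:
  assumes "valid_block b" "ordered_basis sU U us" "ordered_basis sV V vs"
    and "represented_by sV us vs A (block_A b)" "represented_by sV us vs B (block_B b)"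
  shows "has_blocks sU U sV V A B [b]"
  unfolding has_blocks_def using assms
  by (intro exI[of _ us] exI[of _ vs]) (simp del: diag_block_mat.simps)

section \<open>Lagrange interpolation\<close>

lemma poly_eq_sum_degree_less:
  fixes p :: "'a::comm_ring_1 poly"
  assumes "degree p < n"
  shows "poly p x = (\<Sum>k<n. coeff p k * x ^ k)"
proof -
  have "poly p x = (\<Sum>k\<le>degree p. coeff p k * x ^ k)" by (rule poly_altdef)
  also have "\<dots> = (\<Sum>k<n. coeff p k * x ^ k)"
    using assms by (intro sum.mono_neutral_left) (auto simp: coeff_eq_0)
  finally show ?thesis .
qed

lemma poly_eq_0_if_vanishes_on_inj_image:
  fixes d :: "'n::finite \<Rightarrow> 'a::idom"
  assumes "inj d" "degree p < CARD('n)" "\<And>i. poly p (d i) = 0"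
  shows "p = 0"
proof (rule ccontr)
  assume "p \<noteq> 0"
  have "CARD('n) = card (range d)" using assms(1) by (simp add: card_image)
  also have "\<dots> \<le> card {x. poly p x = 0}"
    using assms(3) \<open>p \<noteq> 0\<close> by (intro card_mono poly_roots_finite) auto
  also have "\<dots> \<le> degree p" using \<open>p \<noteq> 0\<close> by (rule poly_roots_degree)
  finally show False using assms(2) by simp
qed

text \<open>The third property compares top coefficients: \<open>p\<close> equals its own
  interpolation polynomial, a combination of the monic polynomials \<open>q i\<close> of degree n -
  1 with coefficients \<open>poly p (d i) * w i\<close>.\<close>

lemma lagrange_interpolation:
  fixes d :: "'n::finite \<Rightarrow> 'a::field"
  assumes d: "inj d"
  obtains w where "\<And>i. w i \<noteq> 0"
    and "\<And>y. \<exists>p. degree p < CARD('n) \<and> (\<forall>i. poly p (d i) = y i)"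
    and "\<And>p. degree p < CARD('n) \<Longrightarrow> (\<Sum>i\<in>UNIV. w i * poly p (d i)) = coeff p (CARD('n) - 1)"
proof
  \<comment> \<open>The products \<open>w i * q i\<close> are the Lagrange basis polynomials: 1 at
    \<open>d i\<close> and 0 at the other nodes.\<close>
  define q where "q i = (\<Prod>j\<in>UNIV - {i}. [:- d j, 1:])" for i
  define w where "w i = 1 / poly (q i) (d i)" for i
  define L where "L y = (\<Sum>i\<in>UNIV. Polynomial.smult (y i * w i) (q i))" for y
  have deg_q: "degree (q i) = CARD('n) - 1" for i
    unfolding q_def by (subst degree_prod_eq_sum_degree) (auto simp: card_Diff_singleton)
  have lead_q: "coeff (q i) (CARD('n) - 1) = 1" for i
    using deg_q[of i] lead_coeff_prod[of "\<lambda>j. [:- d j, 1:]" "UNIV - {i}"]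
    by (simp add: q_def)
  have deg_L: "degree (L y) < CARD('n)" for y
  proof -
    have "degree (L y) \<le> CARD('n) - 1"
      unfolding L_def using deg_q by (intro degree_sum_le) (auto intro: order.trans[OF degree_smult_le])
    moreover have "0 < CARD('n)" by simp
    ultimately show ?thesis by linarith
  qed
  have q0: "poly (q i) (d j) = 0" if "i \<noteq> j" for i j
    unfolding q_def using that by (auto simp: poly_prod)
  show w: "w i \<noteq> 0" for i
    using d by (auto simp: w_def q_def poly_prod inj_eq)
  have poly_L: "poly (L y) (d i) = y i" for y i
  proof -
    have "poly (L y) (d i) = (\<Sum>j\<in>{i}. y j * w j * poly (q j) (d i))"
      unfolding L_def poly_sum poly_smult using q0 by (intro sum.mono_neutral_right) auto
    then show ?thesis using w[of i] by (auto simp: w_def)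
  qed
  show "\<exists>p. degree p < CARD('n) \<and> (\<forall>i. poly p (d i) = y i)" for y
    using deg_L poly_L by blast
  show "(\<Sum>i\<in>UNIV. w i * poly p (d i)) = coeff p (CARD('n) - 1)" if "degree p < CARD('n)" for p
  proof -
    let ?y = "\<lambda>i. poly p (d i)"
    have "p - L ?y = 0"
      using deg_L that by (intro poly_eq_0_if_vanishes_on_inj_image[OF d])
        (auto simp: poly_L intro: degree_diff_less)
    then have "coeff p (CARD('n) - 1) = coeff (L ?y) (CARD('n) - 1)" by simp
    also have "\<dots> = (\<Sum>i\<in>UNIV. w i * ?y i)"
      unfolding L_def coeff_sum coeff_smult lead_q by (simp add: mult.commute)
    finally show ?thesis by simp
  qed
qed

section \<open>The pencil at (I, diag d)\<close>

definition diagonal :: "('n \<Rightarrow> complex) \<Rightarrow> complex^'n^'n" where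
  "diagonal d = (\<chi> i j. if i = j then d i else 0)"

lemma diagonal_nth [simp]: "diagonal d $ i $ j = (if i = j then d i else 0)"
  by (simp add: diagonal_def)

lemma trace_diagonal: "Determinants.trace (diagonal d) = (\<Sum>i\<in>UNIV. d i)"
  by (simp add: Determinants.trace_def)

lemma congruence_action_diagonal_nth:
  "congruence_action X (diagonal d) $ i $ j = X $ i $ j * d j + d i * X $ j $ i"
proof -
  have "(\<Sum>k\<in>UNIV. X $ i $ k * (if k = j then d k else 0)) = X $ i $ j * d j"
    by (subst sum.mono_neutral_right[of _ "{j}"]) auto
  moreover have "(\<Sum>k\<in>UNIV. (if i = k then d i else 0) * X $ j $ k) = d i * X $ j $ i"
    by (subst sum.mono_neutral_right[of _ "{i}"]) auto
  ultimately show ?thesis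
    by (simp add: congruence_action_def matrix_matrix_mult_def transpose_def)
qed

lemma congruence_action_one_nth:
  "congruence_action X (diagonal (\<lambda>_. 1)) $ i $ j = X $ i $ j + X $ j $ i"
  by (simp add: congruence_action_diagonal_nth)

text \<open>On a matrix with entries x at (i, j) and y at (j, i), both maps return a multiple of
  E_ij + E_ji, with factors x + y and x * d j + d i * y. These two functionals are independent
  because \<open>d i \<noteq> d j\<close>.\<close>

lemma has_blocks_horizontal:
  fixes d :: "'n::finite \<Rightarrow> complex"
  assumes "inj d" and ij: "i \<noteq> j"
  defines "U \<equiv> {X :: complex^'n^'n. \<forall>k l. (k, l) \<notin> {(i, j), (j, i)} \<longrightarrow> X $ k $ l = 0}"
  shows "has_blocks mat_scale U mat_scale (U \<inter> symmetric_forms)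
    (\<lambda>X. congruence_action X (diagonal (\<lambda>_. 1))) (\<lambda>X. congruence_action X (diagonal d)) [Horizontal 2]"
proof -
  interpret vector_space "mat_scale :: complex \<Rightarrow> complex^'n^'n \<Rightarrow> _"
    by (rule vector_space_mat_scale)
  define e :: "'n \<Rightarrow> 'n \<Rightarrow> complex^'n^'n" where "e p q = (\<chi> k l. if k = p \<and> l = q then 1 else 0)" for p q
  define m where "m x y = mat_scale x (e i j) + mat_scale y (e j i)" for x y
  define \<delta> where "\<delta> = d j - d i"
  have \<delta>: "\<delta> \<noteq> 0" using assms by (auto simp: \<delta>_def inj_eq)
  \<comment> \<open>The first vector spans the kernel of the map at I, the second the kernel of the
    map at \<open>diagonal d\<close>. Division by \<open>\<delta>\<close> makes the other map send
    each of them to \<open>m 1 1\<close>.\<close>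
  define us where "us = [m (1 / \<delta>) (- 1 / \<delta>), m (- d i / \<delta>) (d j / \<delta>)]"
  define vs where "vs = [m 1 1]"
  have m_ij: "m x y $ i $ j = x" and m_ji: "m x y $ j $ i = y" for x y
    using ij by (simp_all add: m_def e_def mat_scale_def)
  have m_U: "m x y \<in> U" for x y by (auto simp: U_def m_def e_def mat_scale_def)
  have U_eqI: "X = Y" if "X \<in> U" "Y \<in> U" "X $ i $ j = Y $ i $ j" "X $ j $ i = Y $ j $ i" for X Y
  proof -
    have "X $ k $ l = Y $ k $ l" for k l
      using that by (cases "(k, l) \<in> {(i, j), (j, i)}") (unfold U_def, blast, simp)
    then show ?thesis by (simp add: Finite_Cartesian_Product.vec_eq_iff)
  qed
  have m_eq: "m x y = m x' y' \<longleftrightarrow> x = x' \<and> y = y'" for x y x' y'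
    using m_ij m_ji by metis
  have U_m: "X = m (X $ i $ j) (X $ j $ i)" if "X \<in> U" for X
    by (rule U_eqI) (simp_all add: that m_U m_ij m_ji)
  have m_scale: "mat_scale c (m x y) = m (c * x) (c * y)" for c x y
    by (simp add: m_def scale_right_distrib)
  have m_add: "m x y + m x' y' = m (x + x') (y + y')" for x y x' y'
    by (simp add: m_def scale_left_distrib)
  have m_0: "m 0 0 = 0"
    by (simp add: m_def)
  have m_sym: "m x x \<in> symmetric_forms" for x
    by (auto simp: symmetric_forms_def transpose_def m_def e_def mat_scale_def
        Finite_Cartesian_Product.vec_eq_iff conj_commute)
  have sub_U: "subspace U"
    unfolding subspace_def U_def mat_scale_def by simp
  have bu: "ordered_basis mat_scale U us"
  proof (rule ordered_basisI[OF vector_space_mat_scale sub_U])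
    show "set us \<subseteq> U" by (auto simp: us_def m_U)
  next
    fix c :: "nat \<Rightarrow> complex" assume "(\<Sum>k<length us. mat_scale (c k) (us ! k)) = 0"
    then have "m (c 0 / \<delta> - c 1 * d i / \<delta>) (- c 0 / \<delta> + c 1 * d j / \<delta>) = m 0 0"
      by (simp add: us_def m_scale m_add m_0[symmetric] lessThan_Suc add.commute)
    then have "c 0 = c 1 * d i" "c 0 = c 1 * d j" using \<delta> by (auto simp: m_eq field_simps)
    then have "c 1 * \<delta> = 0" by (simp add: \<delta>_def algebra_simps)
    then have "c 1 = 0" "c 0 = 0" using \<delta> \<open>c 0 = c 1 * d i\<close> by auto
    then show "\<forall>k<length us. c k = 0" by (auto simp: us_def less_Suc_eq)
  next
    fix X assume "X \<in> U"
    \<comment> \<open>\<open>us\<close> is dual to the two functionals, so the coordinates of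
      \<open>X\<close> are their values: the one for \<open>diagonal d\<close> first, the one for I
      second.\<close>
    define c where "c k = (if k = 0 then X $ i $ j * d j + d i * X $ j $ i else X $ i $ j + X $ j $ i)"
      for k :: nat
    have "(\<Sum>k<length us. mat_scale (c k) (us ! k)) = m (X $ i $ j) (X $ j $ i)"
      using \<delta> by (simp add: us_def m_scale m_add lessThan_Suc c_def m_eq field_simps)
        (simp add: \<delta>_def algebra_simps)
    then show "\<exists>c. X = (\<Sum>k<length us. mat_scale (c k) (us ! k))"
      using U_m[OF \<open>X \<in> U\<close>] by metis
  qed
  have bv: "ordered_basis mat_scale (U \<inter> symmetric_forms) vs"
  proof (rule ordered_basisI[OF vector_space_mat_scale])
    show "subspace (U \<inter> symmetric_forms)"
      using sub_U subspace_symmetric_forms by (rule subspace_inter)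
    show "set vs \<subseteq> U \<inter> symmetric_forms" by (auto simp: vs_def m_U m_sym)
  next
    fix c :: "nat \<Rightarrow> complex" assume "(\<Sum>k<length vs. mat_scale (c k) (vs ! k)) = 0"
    then show "\<forall>k<length vs. c k = 0" by (simp add: vs_def m_scale m_0[symmetric] m_eq)
  next
    fix X assume "X \<in> U \<inter> symmetric_forms"
    then have X: "X \<in> U" "transpose X = X" by (auto simp: symmetric_forms_def)
    have "X $ j $ i = transpose X $ i $ j" by (simp only: transpose_def vec_lambda_beta)
    then have "X = m (X $ i $ j) (X $ i $ j)" using U_m[OF X(1)] X(2) by metis
    then show "\<exists>c. X = (\<Sum>k<length vs. mat_scale (c k) (vs ! k))"
      by (intro exI[of _ "\<lambda>_. X $ i $ j"]) (simp add: vs_def m_scale del: split_paired_Ex)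
  qed
  have act_U: "congruence_action X (diagonal c) \<in> U" if "X \<in> U" for X c
    using that unfolding U_def by (auto simp: congruence_action_diagonal_nth)
  have A: "congruence_action (m x y) (diagonal (\<lambda>_. 1)) = m (x + y) (x + y)" for x y
    by (rule U_eqI) (simp_all add: act_U m_U congruence_action_one_nth m_ij m_ji)
  have B: "congruence_action (m x y) (diagonal d) = m (x * d j + d i * y) (x * d j + d i * y)" for x y
    by (rule U_eqI) (simp_all add: act_U m_U congruence_action_diagonal_nth m_ij m_ji algebra_simps)
  have len: "length us = 2" by (simp add: us_def)
  have nth: "congruence_action (us ! 0) (diagonal (\<lambda>_. 1)) = m 0 0"
    "congruence_action (us ! 1) (diagonal (\<lambda>_. 1)) = m 1 1"
    "congruence_action (us ! 0) (diagonal d) = m 1 1"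
    "congruence_action (us ! 1) (diagonal d) = m 0 0"
    using \<delta> by (simp_all add: us_def A B m_eq divide_simps) (simp_all add: \<delta>_def)
  have rep: "represented_by mat_scale us vs (\<lambda>X. congruence_action X (diagonal (\<lambda>_. 1))) (zero_one_block 2)"
    "represented_by mat_scale us vs (\<lambda>X. congruence_action X (diagonal d)) (one_zero_block 2)"
    unfolding represented_by_def using nth
    by (auto simp: zero_one_block_def one_zero_block_def less_Suc_eq numeral_2_eq_2 m_scale len vs_def)
  show ?thesis
    using bu bv rep by (intro has_blocks_singletonI) auto
qed

text \<open>On diagonal matrices the two maps are X \<mapsto> 2 X and X \<mapsto> 2 (diag d) X, so
  on the matrices \<open>y k\<close> they keep the exponent or raise it by one, up to the factor
  2.\<close>

lemma has_blocks_vertical: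
  fixes d :: "'n::finite \<Rightarrow> complex"
  assumes d: "inj d"
  shows "has_blocks mat_scale {X \<in> sl. \<forall>k l. k \<noteq> l \<longrightarrow> X $ k $ l = 0}
    mat_scale {X :: complex^'n^'n. \<forall>k l. k \<noteq> l \<longrightarrow> X $ k $ l = 0}
    (\<lambda>X. congruence_action X (diagonal (\<lambda>_. 1))) (\<lambda>X. congruence_action X (diagonal d))
    [Vertical CARD('n)]"
    (is "has_blocks _ ?U _ ?V _ _ _")
proof -
  interpret vector_space "mat_scale :: complex \<Rightarrow> complex^'n^'n \<Rightarrow> _"
    by (rule vector_space_mat_scale)
  obtain w where w0: "\<And>i. w i \<noteq> 0"
    and w_ex: "\<And>y. \<exists>p. degree p < CARD('n) \<and> (\<forall>i. poly p (d i) = y i)"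
    and w_sum: "\<And>p. degree p < CARD('n) \<Longrightarrow> (\<Sum>i\<in>UNIV. w i * poly p (d i)) = coeff p (CARD('n) - 1)"
    by (rule lagrange_interpolation[OF d]) (rule that)
  define n where "n = CARD('n)"
  have n: "n > 0" by (simp add: n_def)
  define y where "y k = diagonal (\<lambda>i. d i ^ k * w i)" for k
  \<comment> \<open>Exponents descend because \<open>block_A\<close> sends the j-th source vector to
    target j + 1 and \<open>block_B\<close> sends it to target j, while the second map raises the
    exponent. The factor 1/2 cancels the 2 in X + X^T = 2 X. The top exponent n - 1 occurs only in
    \<open>vs\<close>.\<close>
  define us where "us = map (\<lambda>j. mat_scale (1/2) (y (n - 1 - Suc j))) [0..<n-1]"
  define vs where "vs = map (\<lambda>j. y (n - Suc j)) [0..<n]"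
  have V_eq: "X = diagonal (\<lambda>i. X $ i $ i)" if "X \<in> ?V" for X :: "complex^'n^'n"
    using that by (auto simp: Finite_Cartesian_Product.vec_eq_iff)
  \<comment> \<open>Combinations of the \<open>y k\<close> are thereby values of polynomials, so
    independence and spanning reduce to root counting and interpolation.\<close>
  have sum_y: "(\<Sum>k<m. mat_scale (coeff p k * c) (y k)) = diagonal (\<lambda>i. c * poly p (d i) * w i)"
    if "degree p < m" for p m c
    using poly_eq_sum_degree_less[OF that]
    by (auto simp: Finite_Cartesian_Product.vec_eq_iff y_def mat_scale_def sum_distrib_left
        sum_distrib_right mult.assoc mult.left_commute)
  have rev: "(\<Sum>k<m. g (m - Suc k)) = (\<Sum>k<m. g k)" for m and g :: "nat \<Rightarrow> complex^'n^'n"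
    by (rule sum.nat_diff_reindex)
  \<comment> \<open>The bound \<open>m\<close> is left free because it is needed for
    \<open>us\<close> with m = n - 1 and for \<open>vs\<close> with m = n.\<close>
  have indep: "\<forall>k<m. c k = 0" if "m \<le> n" "(\<Sum>k<m. mat_scale (c k) (y k)) = 0" for m c
  proof -
    define p where "p = (\<Sum>k<m. Polynomial.monom (c k) k)"
    have cp: "coeff p k = (if k < m then c k else 0)" for k
      by (auto simp: p_def coeff_sum)
    have dp: "degree p < n"
      using n that(1) by (intro degree_lessI) (auto simp: cp)
    have "0 = (\<Sum>k<m. mat_scale (coeff p k * 1) (y k))"
      using that(2) by (simp add: cp)
    also have "\<dots> = (\<Sum>k<n. mat_scale (coeff p k * 1) (y k))"
      using that(1) by (intro sum.mono_neutral_left) (auto simp: cp)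
    also have "\<dots> = diagonal (\<lambda>i. 1 * poly p (d i) * w i)" by (rule sum_y[OF dp])
    finally have "(0 :: complex^'n^'n) $ i $ i = diagonal (\<lambda>i. 1 * poly p (d i) * w i) $ i $ i" for i
      by simp
    then have "poly p (d i) = 0" for i using w0 by simp
    then have "p = 0" using poly_eq_0_if_vanishes_on_inj_image[OF d] dp by (simp add: n_def)
    then show ?thesis using cp by (metis coeff_0)
  qed
  have exp: "\<exists>p. degree p < n \<and> X = (\<Sum>k<n. mat_scale (coeff p k) (y k))"
    if "X \<in> ?V" for X
  proof -
    obtain p where p: "degree p < n" "\<And>i. poly p (d i) = X $ i $ i / w i"
      using w_ex[of "\<lambda>i. X $ i $ i / w i"] by (auto simp: n_def)
    have "(\<Sum>k<n. mat_scale (coeff p k) (y k)) = diagonal (\<lambda>i. X $ i $ i)"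
      using sum_y[OF p(1), of 1] p(2) w0 by simp
    then show ?thesis using V_eq[OF that] p(1) by metis
  qed
  have sub_V: "subspace ?V" by (simp add: subspace_def mat_scale_def)
  have sub_U: "subspace ?U"
    using subspace_inter[OF subspace_sl sub_V] by (simp add: Int_def conj_commute)
  \<comment> \<open>The trace is the top coefficient, so a traceless combination involves only
    exponents below n - 1; this yields spanning by \<open>us\<close>.\<close>
  have tr: "Determinants.trace (\<Sum>k<n. mat_scale (coeff p k) (y k)) = coeff p (n - 1)"
    if "degree p < n" for p
    using sum_y[OF that, of 1] w_sum[of p] that by (simp add: trace_diagonal n_def mult.commute)
  have y_tr: "y k \<in> ?U" if "k < n - 1" for k
  proof -
    have "(\<Sum>i\<in>UNIV. d i ^ k * w i) = 0"
      using w_sum[of "Polynomial.monom 1 k"] that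
      by (simp add: poly_monom degree_monom_eq n_def mult.commute)
    then show ?thesis by (simp add: y_def sl_def trace_diagonal)
  qed
  have len: "length us = n - 1" "length vs = n" by (simp_all add: us_def vs_def)
  have sum_us: "(\<Sum>k<length us. mat_scale (c k) (us ! k)) =
      (\<Sum>k<n - 1. mat_scale (c (n - 1 - Suc k) / 2) (y k))" for c
  proof -
    have "n - 1 - Suc (n - 1 - Suc k) = k" if "k < n - 1" for k using that by simp
    then show ?thesis
      unfolding rev[of "\<lambda>k. mat_scale (c (n - 1 - Suc k) / 2) (y k)" "n - 1", symmetric]
      by (intro sum.cong) (auto simp: us_def)
  qed
  have sum_vs: "(\<Sum>k<length vs. mat_scale (c k) (vs ! k)) =
      (\<Sum>k<n. mat_scale (c (n - Suc k)) (y k))" for c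
    using rev[of "\<lambda>k. mat_scale (c (n - Suc k)) (y k)" n]
    by (simp add: len) (auto simp: vs_def intro!: sum.cong)
  have bu: "ordered_basis mat_scale ?U us"
  proof (rule ordered_basisI[OF vector_space_mat_scale sub_U])
    show "set us \<subseteq> ?U"
      unfolding us_def set_map
    proof (intro image_subsetI subspace_scale[OF sub_U] y_tr)
    qed auto
  next
    fix c :: "nat \<Rightarrow> complex" assume "(\<Sum>k<length us. mat_scale (c k) (us ! k)) = 0"
    then have *: "\<forall>k<n - 1. c (n - 1 - Suc k) / 2 = 0" unfolding sum_us by (intro indep) auto
    show "\<forall>k<length us. c k = 0"
    proof (intro allI impI)
      fix k assume "k < length us"
      then have "n - 1 - Suc k < n - 1" "n - 1 - Suc (n - 1 - Suc k) = k" by (auto simp: len)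
      with * show "c k = 0" by fastforce
    qed
  next
    fix X assume X: "X \<in> ?U"
    then obtain p where p: "degree p < n" "X = (\<Sum>k<n. mat_scale (coeff p k) (y k))"
      using exp[of X] by auto
    have "coeff p (n - 1) = 0" using tr[OF p(1)] p(2) X by (simp add: sl_def)
    then have "X = (\<Sum>k<n - 1. mat_scale (coeff p k) (y k))"
      using n unfolding p(2) by (cases n) auto
    also have "\<dots> = (\<Sum>k<length us. mat_scale (2 * coeff p (n - 1 - Suc k)) (us ! k))"
      unfolding sum_us
    proof (intro sum.cong refl)
      fix k assume "k \<in> {..<n - 1}"
      then have "n - 1 - Suc (n - 1 - Suc k) = k" by auto
      then show "mat_scale (coeff p k) (y k) =
          mat_scale (2 * coeff p (n - 1 - Suc (n - 1 - Suc k)) / 2) (y k)" by (simp only:) simp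
    qed
    finally show "\<exists>c. X = (\<Sum>k<length us. mat_scale (c k) (us ! k))"
      by (rule exI[of _ "\<lambda>k. 2 * coeff p (n - 1 - Suc k)"])
  qed
  have bv: "ordered_basis mat_scale ?V vs"
  proof (rule ordered_basisI[OF vector_space_mat_scale sub_V])
    show "set vs \<subseteq> ?V" by (auto simp: vs_def y_def)
  next
    fix c :: "nat \<Rightarrow> complex" assume "(\<Sum>k<length vs. mat_scale (c k) (vs ! k)) = 0"
    then have *: "\<forall>k<n. c (n - Suc k) = 0" unfolding sum_vs by (intro indep) auto
    show "\<forall>k<length vs. c k = 0"
    proof (intro allI impI)
      fix k assume "k < length vs"
      then have "n - Suc k < n" "n - Suc (n - Suc k) = k" by (auto simp: len)
      with * show "c k = 0" by fastforce
    qed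
  next
    fix X assume X: "X \<in> ?V"
    then obtain p where p: "degree p < n" "X = (\<Sum>k<n. mat_scale (coeff p k) (y k))"
      using exp[of X] by auto
    note p(2)
    also have "\<dots> = (\<Sum>k<length vs. mat_scale (coeff p (n - Suc k)) (vs ! k))"
      unfolding sum_vs by (intro sum.cong) auto
    finally show "\<exists>c. X = (\<Sum>k<length vs. mat_scale (c k) (vs ! k))"
      by (rule exI[of _ "\<lambda>k. coeff p (n - Suc k)"])
  qed
  have A: "congruence_action (mat_scale (1/2) (y k)) (diagonal (\<lambda>_. 1)) = y k" for k
    by (auto simp: Finite_Cartesian_Product.vec_eq_iff congruence_action_one_nth y_def mat_scale_def)
  have B: "congruence_action (mat_scale (1/2) (y k)) (diagonal d) = y (Suc k)" for k
    by (auto simp: Finite_Cartesian_Product.vec_eq_iff congruence_action_diagonal_nth y_def mat_scale_def)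
  have pick: "(\<Sum>i<n. mat_scale (if i = k then 1 else 0) (vs ! i)) = vs ! k" if "k < n" for k
  proof -
    have "(\<Sum>i<n. mat_scale (if i = k then 1 else 0) (vs ! i)) =
        (\<Sum>i\<in>{k}. mat_scale (if i = k then 1 else 0) (vs ! i))"
      using that by (intro sum.mono_neutral_right) auto
    then show ?thesis by simp
  qed
  have "represented_by mat_scale us vs (\<lambda>X. congruence_action X (diagonal (\<lambda>_. 1))) (block_A (Vertical n))"
    unfolding represented_by_def
  proof (intro conjI allI impI)
    fix j assume "j < length us"
    then have j: "j < n - 1" by (simp add: len)
    have "(\<Sum>i<length vs. mat_scale (block_A (Vertical n) $$ (i, j)) (vs ! i)) =
        (\<Sum>i<n. mat_scale (if i = j + 1 then 1 else 0) (vs ! i))"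
      using j by (intro sum.cong) (auto simp: len zero_one_block_def)
    also have "\<dots> = vs ! (j + 1)" using j by (intro pick) auto
    also have "\<dots> = congruence_action (us ! j) (diagonal (\<lambda>_. 1))"
      using j by (simp add: us_def vs_def A less_diff_conv)
    finally show "congruence_action (us ! j) (diagonal (\<lambda>_. 1)) =
      (\<Sum>i<length vs. mat_scale (block_A (Vertical n) $$ (i, j)) (vs ! i))" by simp
  qed (auto simp: zero_one_block_def len)
  moreover have "represented_by mat_scale us vs (\<lambda>X. congruence_action X (diagonal d)) (block_B (Vertical n))"
    unfolding represented_by_def
  proof (intro conjI allI impI)
    fix j assume "j < length us"
    then have j: "j < n - 1" by (simp add: len)
    have "(\<Sum>i<length vs. mat_scale (block_B (Vertical n) $$ (i, j)) (vs ! i)) =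
        (\<Sum>i<n. mat_scale (if i = j then 1 else 0) (vs ! i))"
      using j by (intro sum.cong) (auto simp: len one_zero_block_def)
    also have "\<dots> = vs ! j" using j by (intro pick) auto
    also have "\<dots> = congruence_action (us ! j) (diagonal d)"
      using j by (simp add: us_def vs_def B Suc_diff_Suc less_diff_conv)
    finally show "congruence_action (us ! j) (diagonal d) =
      (\<Sum>i<length vs. mat_scale (block_B (Vertical n) $$ (i, j)) (vs ! i))" by simp
  qed (auto simp: one_zero_block_def len)
  ultimately show ?thesis
    using bu bv n unfolding n_def by (intro has_blocks_singletonI) auto
qed

lemma has_blocks_diagonal:
  fixes d :: "'n::finite \<Rightarrow> complex" and P :: "('n \<times> 'n) set"
  assumes d: "inj d" and P: "finite P" "\<And>k l. (k, l) \<in> P \<Longrightarrow> (l, k) \<notin> P"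
  shows "has_blocks
    mat_scale {X \<in> sl. \<forall>k l. k \<noteq> l \<and> (k, l) \<notin> P \<and> (l, k) \<notin> P \<longrightarrow> X $ k $ l = 0}
    mat_scale {X \<in> symmetric_forms. \<forall>k l. k \<noteq> l \<and> (k, l) \<notin> P \<and> (l, k) \<notin> P \<longrightarrow> X $ k $ l = 0}
    (\<lambda>X. congruence_action X (diagonal (\<lambda>_. 1))) (\<lambda>X. congruence_action X (diagonal d))
    (replicate (card P) (Horizontal 2) @ [Vertical CARD('n)])"
    (is "has_blocks _ (?U P) _ (?V P) ?A ?B _")
  using P
proof (induction P rule: finite_induct)
  case empty
  have "X \<in> symmetric_forms" if "\<forall>k l. k \<noteq> l \<longrightarrow> X $ k $ l = 0" for X :: "complex^'n^'n"
  proof -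
    have "X $ k $ l = X $ l $ k" for k l using that by (cases "k = l") auto
    then show ?thesis by (simp add: symmetric_forms_def transpose_def Finite_Cartesian_Product.vec_eq_iff)
  qed
  then have "?V {} = {X. \<forall>k l. k \<noteq> l \<longrightarrow> X $ k $ l = 0}" by auto
  then show ?case using has_blocks_vertical[OF d] by simp
next
  case (insert p P)
  obtain i j where p: "p = (i, j)" by (cases p)
  have ij: "i \<noteq> j" using insert.prems[of i j] p by auto
  define H where "H = {X :: complex^'n^'n. \<forall>k l. (k, l) \<notin> {(i, j), (j, i)} \<longrightarrow> X $ k $ l = 0}"
  \<comment> \<open>The projection onto the new plane \<open>H\<close>; it preserves symmetry, and X
    = r X + (X - r X) decomposes both the source and the target.\<close>
  define r where "r X = (\<chi> k l. if (k, l) \<in> {(i, j), (j, i)} then X $ k $ l else 0)" for X :: "complex^'n^'n"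
  have notin: "(i, j) \<notin> P" "(j, i) \<notin> P"
    using insert.hyps(2) insert.prems[of i j] p by auto
  have sl_add: "X + Y \<in> sl" if "X \<in> sl" "Y \<in> sl" for X Y :: "complex^'n^'n"
    using that by (simp add: sl_def Determinants.trace_add)
  have sl_diff: "X - Y \<in> sl" if "X \<in> sl" "Y \<in> sl" for X Y :: "complex^'n^'n"
    using that by (simp add: sl_def Determinants.trace_sub)
  have H_sl: "X \<in> sl" if "X \<in> H" for X
  proof -
    have "X $ k $ k = 0" for k
    proof -
      have "(k, k) \<notin> {(i, j), (j, i)}" using ij by blast
      then show ?thesis using that unfolding H_def by blast
    qed
    then show ?thesis by (simp add: sl_def Determinants.trace_def)
  qed
  have sym: "X \<in> symmetric_forms \<longleftrightarrow> (\<forall>k l. X $ k $ l = X $ l $ k)" for X :: "complex^'n^'n"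
    unfolding symmetric_forms_def transpose_def Finite_Cartesian_Product.vec_eq_iff by simp metis
  have r_H: "r X \<in> H" for X by (simp add: r_def H_def)
  have r_sym: "r X \<in> symmetric_forms" if "X \<in> symmetric_forms" for X
    unfolding sym
  proof (intro allI)
    fix k l
    have "(k, l) \<in> {(i, j), (j, i)} \<longleftrightarrow> (l, k) \<in> {(i, j), (j, i)}" by blast
    moreover have "X $ k $ l = X $ l $ k" using that sym by blast
    ultimately show "r X $ k $ l = r X $ l $ k" unfolding r_def vec_lambda_beta by presburger
  qed
  have sym_add: "X + Y \<in> symmetric_forms" if "X \<in> symmetric_forms" "Y \<in> symmetric_forms"
    for X Y :: "complex^'n^'n" using that by (simp add: sym)
  have sym_diff: "X - Y \<in> symmetric_forms" if "X \<in> symmetric_forms" "Y \<in> symmetric_forms"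
    for X Y :: "complex^'n^'n" using that by (simp add: sym)
  define off where "off Q X \<longleftrightarrow> (\<forall>k l. k \<noteq> l \<and> (k, l) \<notin> Q \<and> (l, k) \<notin> Q \<longrightarrow> X $ k $ l = 0)"
    for Q and X :: "complex^'n^'n"
  have off_add: "off (insert p P) (X + Y)" if "X \<in> H" "off P Y" for X Y
  proof -
    have "(X + Y) $ k $ l = 0" if kl: "k \<noteq> l \<and> (k, l) \<notin> insert p P \<and> (l, k) \<notin> insert p P" for k l
    proof -
      have "X $ k $ l = 0" using kl p \<open>X \<in> H\<close> unfolding H_def by blast
      moreover have "Y $ k $ l = 0" using kl \<open>off P Y\<close> unfolding off_def by blast
      ultimately show ?thesis by simp
    qed
    then show ?thesis unfolding off_def by blast
  qed
  have off_r: "off P (X - r X)" if "off (insert p P) X" for X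
  proof -
    have "(X - r X) $ k $ l = 0" if kl: "k \<noteq> l \<and> (k, l) \<notin> P \<and> (l, k) \<notin> P" for k l
    proof (cases "(k, l) \<in> {(i, j), (j, i)}")
      case True
      then have "r X $ k $ l = X $ k $ l" unfolding r_def vec_lambda_beta by presburger
      then show ?thesis by simp
    next
      case False
      then have "r X $ k $ l = 0" unfolding r_def vec_lambda_beta by presburger
      moreover have "X $ k $ l = 0"
        using \<open>off (insert p P) X\<close> False kl p unfolding off_def by blast
      ultimately show ?thesis by simp
    qed
    then show ?thesis unfolding off_def by blast
  qed
  have disj: "X = 0" if "X \<in> H" "off P X" for X
  proof -
    have "X $ k $ l = 0" for k l
    proof (cases "(k, l) \<in> {(i, j), (j, i)}")
      case True
      then have "k \<noteq> l \<and> (k, l) \<notin> P \<and> (l, k) \<notin> P" using ij notin by blast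
      then show ?thesis using that(2) unfolding off_def by blast
    next
      case False
      then show ?thesis using that(1) unfolding H_def by blast
    qed
    then show ?thesis by (simp add: Finite_Cartesian_Product.vec_eq_iff)
  qed
  have U_eq: "?U Q = {X \<in> sl. off Q X}" and V_eq: "?V Q = {X \<in> symmetric_forms. off Q X}" for Q
    by (simp_all add: off_def)
  have U: "{x + y | x y. x \<in> H \<and> y \<in> ?U P} = ?U (insert p P)"
    unfolding U_eq
  proof (intro equalityI subsetI)
    fix X assume "X \<in> {X \<in> sl. off (insert p P) X}"
    then have "r X \<in> H" "X - r X \<in> {X \<in> sl. off P X}" "X = r X + (X - r X)"
      using r_H H_sl sl_diff off_r by auto
    then show "X \<in> {x + y | x y. x \<in> H \<and> y \<in> {X \<in> sl. off P X}}" by blast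
  qed (use off_add sl_add H_sl in blast)
  have V: "{x + y | x y. x \<in> H \<inter> symmetric_forms \<and> y \<in> ?V P} = ?V (insert p P)"
    unfolding V_eq
  proof (intro equalityI subsetI)
    fix X assume "X \<in> {X \<in> symmetric_forms. off (insert p P) X}"
    then have "r X \<in> H \<inter> symmetric_forms" "X - r X \<in> {X \<in> symmetric_forms. off P X}"
      "X = r X + (X - r X)"
      using r_H r_sym sym_diff off_r by auto
    then show "X \<in> {x + y | x y. x \<in> H \<inter> symmetric_forms \<and> y \<in> {X \<in> symmetric_forms. off P X}}"
      by blast
  qed (use off_add sym_add in blast)
  have hor: "has_blocks mat_scale H mat_scale (H \<inter> symmetric_forms) ?A ?B [Horizontal 2]"
    unfolding H_def by (rule has_blocks_horizontal[OF d ij])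
  have IH: "has_blocks mat_scale (?U P) mat_scale (?V P) ?A ?B
      (replicate (card P) (Horizontal 2) @ [Vertical CARD('n)])"
    using insert.prems by (intro insert.IH) blast
  have "has_blocks mat_scale {x + y | x y. x \<in> H \<and> y \<in> ?U P} mat_scale
    {x + y | x y. x \<in> H \<inter> symmetric_forms \<and> y \<in> ?V P} ?A ?B
    (Horizontal 2 # replicate (card P) (Horizontal 2) @ [Vertical CARD('n)])"
    by (rule has_blocks_Cons[OF vector_space_mat_scale vector_space_mat_scale hor IH])
      (use disj in \<open>auto simp: U_eq V_eq simp del: mem_Collect_eq\<close>)
  then show ?case unfolding U V using insert.hyps by simp
qed

lemma has_blocks_congruence_action_diagonal:
  fixes d :: "'n::finite \<Rightarrow> complex"
  assumes "inj d"
  shows "has_blocks mat_scale (sl :: (complex^'n^'n) set) mat_scale symmetric_forms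
    (\<lambda>X. congruence_action X (diagonal (\<lambda>_. 1))) (\<lambda>X. congruence_action X (diagonal d))
    (replicate (CARD('n) * (CARD('n) - 1) div 2) (Horizontal 2) @ [Vertical CARD('n)])"
proof -
  \<comment> \<open>The index type carries no order; an injection into the naturals supplies one, so
    that each unordered pair is chosen once.\<close>
  obtain f :: "'n \<Rightarrow> nat" where f: "inj f"
    using finite_imp_inj_to_nat_seg[of "UNIV :: 'n set"] by auto
  define P where "P = {(k, l). f k < f l}"
  have all: "(k, l) \<in> P \<or> (l, k) \<in> P" if "k \<noteq> l" for k l
    using inj_eq[OF f, of k l] that by (auto simp: P_def)
  have *: "{X \<in> S. \<forall>k l. k \<noteq> l \<and> (k, l) \<notin> P \<and> (l, k) \<notin> P \<longrightarrow> X $ k $ l = 0} = S"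
    for S :: "(complex^'n^'n) set"
    using all by blast
  have "(Id :: 'n rel) = (\<lambda>k. (k, k)) ` UNIV" by auto
  then have card_Id: "card (Id :: 'n rel) = CARD('n)" using card_image[of "\<lambda>k :: 'n. (k, k)" UNIV] by (simp add: inj_on_def)
  \<comment> \<open>\<open>P\<close> and its converse partition the off-diagonal pairs, whence 2 *
    card P = n * n - n.\<close>
  have "card (P \<union> P\<inverse>) = card P + card (P\<inverse>)"
    by (intro card_Un_disjoint) (auto simp: P_def)
  also have "\<dots> = 2 * card P" by simp
  also have "P \<union> P\<inverse> = UNIV \<times> UNIV - Id" using all by (auto simp: P_def)
  also have "card (UNIV \<times> UNIV - (Id :: 'n rel)) = CARD('n) * CARD('n) - CARD('n)"
    by (subst card_Diff_subset) (auto simp: card_cartesian_product card_Id simp del: UNIV_Times_UNIV)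
  finally have "card P = CARD('n) * (CARD('n) - 1) div 2"
    by (simp add: diff_mult_distrib2)
  moreover have "(l, k) \<notin> P" if "(k, l) \<in> P" for k l using that by (auto simp: P_def)
  ultimately show ?thesis
    using has_blocks_diagonal[OF assms, of P] unfolding * by simp
qed

section \<open>Genericity as the non-vanishing of a polynomial\<close>

lemma polynomial_fun_sum:
  "(\<And>i. i \<in> I \<Longrightarrow> polynomial_fun s (f i)) \<Longrightarrow> polynomial_fun s (\<lambda>x. \<Sum>i\<in>I. f i x)"
  by (induction I rule: infinite_finite_induct) (auto intro: polynomial_fun.intros)

lemma polynomial_fun_prod:
  "(\<And>i. i \<in> I \<Longrightarrow> polynomial_fun s (f i)) \<Longrightarrow> polynomial_fun s (\<lambda>x. \<Prod>i\<in>I. f i x)"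
  by (induction I rule: infinite_finite_induct) (auto intro: polynomial_fun.intros)

lemma polynomial_fun_det:
  assumes "\<And>i j. i < n \<Longrightarrow> j < n \<Longrightarrow> polynomial_fun s (\<lambda>x. M x $$ (i, j))"
    and "\<And>x. M x \<in> carrier_mat n n"
  shows "polynomial_fun s (\<lambda>x. Determinant.det (M x))"
proof -
  have "Determinant.det (M x) = (\<Sum> p \<in> {p. p permutes {0 ..< n}}. signof p * (\<Prod> i = 0 ..< n. M x $$ (i, p i)))"
    for x using assms(2)[of x] by (auto simp: Determinant.det_def)
  moreover have "polynomial_fun s (\<lambda>x. \<Sum> p \<in> {p. p permutes {0 ..< n}}. signof p * (\<Prod> i = 0 ..< n. M x $$ (i, p i)))"
    by (intro polynomial_fun_sum polynomial_fun.mult polynomial_fun.const polynomial_fun_prod assms(1))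
      (auto dest: permutes_in_image)
  ultimately show ?thesis by simp
qed

lemma polynomial_fun_coeff_mult:
  assumes "\<And>k. polynomial_fun s (\<lambda>x. coeff (f x) k)" "\<And>k. polynomial_fun s (\<lambda>x. coeff (g x) k)"
  shows "polynomial_fun s (\<lambda>x. coeff (f x * g x) k)"
  unfolding coeff_mult by (intro polynomial_fun_sum polynomial_fun.mult assms)

lemma polynomial_fun_coeff_prod:
  assumes "\<And>i k. i \<in> I \<Longrightarrow> polynomial_fun s (\<lambda>x. coeff (f i x) k)"
  shows "polynomial_fun s (\<lambda>x. coeff (\<Prod>i\<in>I. f i x) k)"
  using assms
proof (induction I arbitrary: k rule: infinite_finite_induct)
  case (insert i I)
  then show ?case by (auto intro: polynomial_fun_coeff_mult)
qed (auto intro: polynomial_fun.const)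

text \<open>This is det (t a - b) as a polynomial in t. In this orientation the coefficient at n is
  det a, and the roots for (I, diag d) are the \<open>d i\<close> themselves.\<close>

definition pencil_poly :: "complex^'n^'n \<Rightarrow> complex^'n^'n \<Rightarrow> complex poly" where
  "pencil_poly a b = Determinants.det (\<chi> i j. [:- b $ i $ j, a $ i $ j:])"

lemma polynomial_fun_coeff_pencil_poly:
  assumes "\<And>i j. polynomial_fun s (\<lambda>x. f x $ i $ j)" "\<And>i j. polynomial_fun s (\<lambda>x. g x $ i $ j)"
  shows "polynomial_fun s (\<lambda>x. coeff (pencil_poly (f x) (g x)) k)"
proof -
  have entry: "polynomial_fun s (\<lambda>x. coeff [:- g x $ i $ j, f x $ i $ j:] k)" for i j k
  proof -
    have "polynomial_fun s (\<lambda>x. -1 * g x $ i $ j)"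
      by (intro polynomial_fun.mult polynomial_fun.const assms)
    then show ?thesis
      using assms polynomial_fun.const[of s 0] by (cases k rule: nat.exhaust; cases "k - 1") auto
  qed
  show ?thesis
    unfolding pencil_poly_def Determinants.det_def coeff_sum vec_lambda_beta
    by (intro polynomial_fun_sum polynomial_fun_coeff_mult polynomial_fun_coeff_prod entry polynomial_fun.const)
qed

lemma poly_pencil_poly: "poly (pencil_poly a b) t = Determinants.det (mat_scale t a - b)"
  by (simp add: pencil_poly_def Determinants.det_def poly_sum poly_prod mat_scale_def)

text \<open>Some \<open>a i\<close> may vanish, so the coefficient at \<open>card I\<close> is
  meant, which need not be the leading one.\<close>

lemma coeff_prod_linear:
  assumes "finite I"
  shows "degree (\<Prod>i\<in>I. [:b i, a i:]) \<le> card I \<and> coeff (\<Prod>i\<in>I. [:b i, a i:]) (card I) = (\<Prod>i\<in>I. a i)"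
  using assms
proof (induction I rule: finite_induct)
  case (insert i I)
  let ?p = "\<Prod>i\<in>I. [:b i, a i:]"
  have IH: "degree ?p \<le> card I" "coeff ?p (card I) = (\<Prod>i\<in>I. a i)"
    using insert.IH by auto
  have "degree ([:b i, a i:] * ?p) \<le> degree [:b i, a i:] + degree ?p" by (rule degree_mult_le)
  also have "\<dots> \<le> 1 + card I" using IH(1) by (intro add_mono) auto
  finally have "degree ([:b i, a i:] * ?p) \<le> Suc (card I)" by simp
  moreover have "coeff ([:b i, a i:] * ?p) (Suc (card I)) = a i * coeff ?p (card I)"
    using IH(1) by (simp add: coeff_eq_0)
  ultimately show ?case using insert.hyps IH(2) by simp
qed auto

text \<open>Each Leibniz term is a product of n linear factors, whose coefficient at n is the
  corresponding term of det a.\<close>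

lemma degree_pencil_poly_le: "degree (pencil_poly a (b :: complex^'n^'n)) \<le> CARD('n)"
  and coeff_pencil_poly: "coeff (pencil_poly a b) CARD('n) = Determinants.det a"
proof -
  let ?t = "\<lambda>p. \<Prod>i\<in>UNIV. [:- b $ i $ p i, a $ i $ p i:]"
  have t: "degree (?t p) \<le> CARD('n)" "coeff (?t p) CARD('n) = (\<Prod>i\<in>UNIV. a $ i $ p i)" for p
    using coeff_prod_linear[of UNIV "\<lambda>i. - b $ i $ p i" "\<lambda>i. a $ i $ p i"] by auto
  have sgn: "of_int (sign p) * q = Polynomial.smult (of_int (sign p)) q" for p :: "'n \<Rightarrow> 'n" and q :: "complex poly"
    by (simp add: of_int_poly)
  show "degree (pencil_poly a b) \<le> CARD('n)"
    unfolding pencil_poly_def Determinants.det_def vec_lambda_beta sgn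
    by (intro degree_sum_le) (auto intro: order.trans[OF degree_smult_le] t)
  show "coeff (pencil_poly a b) CARD('n) = Determinants.det a"
    unfolding pencil_poly_def Determinants.det_def vec_lambda_beta sgn by (simp add: coeff_sum t)
qed

text \<open>The size of the Sylvester matrix is fixed, so that its determinant is polynomial also where
  \<open>det a = 0\<close> and the degree of \<open>pencil_poly a b\<close> drops.\<close>

definition generic_poly :: "(complex^'n^'n) \<times> (complex^'n^'n) \<Rightarrow> complex" where
  "generic_poly = (\<lambda>(a, b). Determinants.det a * Determinant.det
     (sylvester_mat_sub CARD('n) (CARD('n) - 1) (pencil_poly a b) (pderiv (pencil_poly a b))))"

text \<open>For invertible \<open>a\<close> the degrees of the polynomial and its derivative are
  exactly n and n - 1, so the Sylvester matrix of fixed size is the true one.\<close>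

lemma generic_poly_eq_resultant:
  assumes "Determinants.det (a :: complex^'n^'n) \<noteq> 0"
  shows "generic_poly (a, b) = Determinants.det a * resultant (pencil_poly a b) (pderiv (pencil_poly a b))"
    and "degree (pencil_poly a b) = CARD('n)"
proof -
  show "degree (pencil_poly a b) = CARD('n)"
    using assms by (metis coeff_pencil_poly degree_pencil_poly_le le_antisym le_degree)
  then show "generic_poly (a, b) = Determinants.det a * resultant (pencil_poly a b) (pderiv (pencil_poly a b))"
    by (simp add: generic_poly_def resultant_def sylvester_mat_def degree_pderiv)
qed

text \<open>The resultant vanishes iff the gcd is non-constant, and over the complex numbers a
  non-constant gcd has a root.\<close>

lemma resultant_eq_0_iff_common_root:
  fixes p q :: "complex poly"
  assumes "p \<noteq> 0"
  shows "resultant p q = 0 \<longleftrightarrow> (\<exists>t. poly p t = 0 \<and> poly q t = 0)"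
proof
  assume "resultant p q = 0"
  then have "degree (gcd p q) \<noteq> 0" by (simp add: resultant_0_gcd)
  then have "\<not> constant (poly (gcd p q))" by (simp add: constant_degree)
  then obtain t where "poly (gcd p q) t = 0" using fundamental_theorem_of_algebra by blast
  then show "\<exists>t. poly p t = 0 \<and> poly q t = 0"
    by (metis dvdE gcd_dvd1 gcd_dvd2 mult_zero_left poly_mult)
next
  assume "\<exists>t. poly p t = 0 \<and> poly q t = 0"
  then obtain t where "[:- t, 1:] dvd p" "[:- t, 1:] dvd q" by (auto simp: poly_eq_0_iff_dvd)
  then have "[:- t, 1:] dvd gcd p q" by simp
  moreover have "gcd p q \<noteq> 0" using assms by simp
  ultimately have "degree [:- t, 1:] \<le> degree (gcd p q)" by (intro dvd_imp_degree_le)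
  then show "resultant p q = 0" by (simp add: resultant_0_gcd)
qed

lemma generic_poly_polynomial_fun:
  "polynomial_fun (module_prod.scale mat_scale mat_scale) (generic_poly :: (complex^'n^'n) \<times> _ \<Rightarrow> _)"
proof -
  interpret M: vector_space_prod "mat_scale :: complex \<Rightarrow> complex^'n^'n \<Rightarrow> _"
    "mat_scale :: complex \<Rightarrow> complex^'n^'n \<Rightarrow> _"
    by (intro vector_space_prod.intro vector_space_pair.intro vector_space_mat_scale)
  have vs1: "vector_space ((*) :: complex \<Rightarrow> complex \<Rightarrow> complex)"
    by unfold_locales (auto simp: algebra_simps)
  have fst: "polynomial_fun M.scale (\<lambda>x. fst x $ i $ j)" and snd: "polynomial_fun M.scale (\<lambda>x. snd x $ i $ j)" for i j
    by (auto intro!: polynomial_fun.linear simp: Vector_Spaces.linear_iff vs1 M.p.vector_space_axioms M.scale_def mat_scale_def)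
  have c: "polynomial_fun M.scale (\<lambda>x. coeff (pencil_poly (fst x) (snd x)) k)" for k
    by (intro polynomial_fun_coeff_pencil_poly fst snd)
  have c': "polynomial_fun M.scale (\<lambda>x. coeff (pderiv (pencil_poly (fst x) (snd x))) k)" for k
    unfolding coeff_pderiv by (intro polynomial_fun.mult polynomial_fun.const c)
  have "polynomial_fun M.scale (\<lambda>x. Determinants.det (fst x))"
    unfolding Determinants.det_def
    by (intro polynomial_fun_sum polynomial_fun.mult polynomial_fun.const polynomial_fun_prod fst)
  moreover have "polynomial_fun M.scale (\<lambda>x. Determinant.det
     (sylvester_mat_sub CARD('n) (CARD('n) - 1) (pencil_poly (fst x) (snd x)) (pderiv (pencil_poly (fst x) (snd x)))))"
  proof (rule polynomial_fun_det[OF _ sylvester_mat_sub_carrier])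
    fix i j assume ij: "i < CARD('n) + (CARD('n) - 1)" "j < CARD('n) + (CARD('n) - 1)"
    \<comment> \<open>The conditions selecting a Sylvester entry depend on the position only, not on
      the point \<open>x\<close>.\<close>
    have if_const: "polynomial_fun M.scale (\<lambda>x. if P then f x else g x)"
      if "polynomial_fun M.scale f" "polynomial_fun M.scale g" for P f g
      using that by (cases P) auto
    show "polynomial_fun M.scale (\<lambda>x. sylvester_mat_sub CARD('n) (CARD('n) - 1)
      (pencil_poly (fst x) (snd x)) (pderiv (pencil_poly (fst x) (snd x))) $$ (i, j))"
      unfolding sylvester_mat_sub_index[OF ij] by (intro if_const c c' polynomial_fun.const)
  qed
  ultimately show ?thesis
    unfolding generic_poly_def case_prod_unfold by (rule polynomial_fun.mult)
qed

lemma pencil_poly_diagonal: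
  "pencil_poly (diagonal (\<lambda>_. 1)) (diagonal d) = (\<Prod>i\<in>UNIV. [:- d i, 1:])"
proof -
  have "pencil_poly (diagonal (\<lambda>_. 1)) (diagonal d) =
      (\<Prod>i\<in>UNIV. (\<chi> i j. [:- diagonal d $ i $ j, diagonal (\<lambda>_. 1) $ i $ j:]) $ i $ i)"
    unfolding pencil_poly_def by (rule Determinants.det_diagonal) simp
  then show ?thesis by simp
qed

text \<open>Provides the point showing that the generic set is non-empty.\<close>

lemma generic_poly_diagonal_nonzero:
  fixes d :: "'n::finite \<Rightarrow> complex"
  assumes "inj d"
  shows "generic_poly (diagonal (\<lambda>_. 1), diagonal d) \<noteq> 0"
proof -
  let ?p = "\<Prod>i\<in>UNIV. [:- d i, 1:]"
  have det: "Determinants.det (diagonal (\<lambda>_. 1) :: complex^'n^'n) = 1"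
    by (subst Determinants.det_diagonal) auto
  have "poly (pderiv ?p) (d i) = (\<Prod>j\<in>UNIV - {i}. d i - d j)" for i
  proof -
    have "poly (pderiv ?p) (d i) = (\<Sum>k\<in>UNIV. \<Prod>j\<in>UNIV - {k}. d i - d j)"
      by (simp add: pderiv_prod poly_sum poly_prod pderiv_pCons)
    \<comment> \<open>For k \<noteq> i the product still contains the factor
      \<open>d i - d i\<close>.\<close>
    also have "\<dots> = (\<Sum>k\<in>{i}. \<Prod>j\<in>UNIV - {k}. d i - d j)"
      by (rule sum.mono_neutral_right) auto
    finally show ?thesis by simp
  qed
  then have "poly (pderiv ?p) (d i) \<noteq> 0" for i
    using assms by (auto simp: inj_eq)
  moreover have "?p \<noteq> 0" by (simp add: prod_zero_iff)
  moreover have "poly ?p t = 0 \<longleftrightarrow> (\<exists>i. t = d i)" for t by (auto simp: poly_prod)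
  ultimately have "resultant ?p (pderiv ?p) \<noteq> 0"
    by (subst resultant_eq_0_iff_common_root) auto
  then show ?thesis
    using det by (simp add: generic_poly_eq_resultant pencil_poly_diagonal)
qed

section \<open>Simultaneous diagonalization of a generic pair\<close>

text \<open>Without a common root with its derivative the polynomial is squarefree, so it has as
  many distinct roots as its degree; \<open>d\<close> is any bijection from the index type onto
  them.\<close>

lemma exists_inj_roots:
  fixes p :: "complex poly"
  assumes "degree p = CARD('n::finite)" and "resultant p (pderiv p) \<noteq> 0"
  obtains d :: "'n::finite \<Rightarrow> complex" where "inj d" "\<And>i. poly p (d i) = 0"
proof -
  have p0: "p \<noteq> 0" using assms(1) by auto
  then have "rsquarefree p"
    using assms(2) by (auto simp: resultant_eq_0_iff_common_root rsquarefree_roots)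
  then have "degree p = degree (Polynomial.smult (lead_coeff p) (\<Prod>z|poly p z = 0. [:-z, 1:]))"
    by (simp only: complex_poly_decompose_rsquarefree)
  also have "\<dots> = card {z. poly p z = 0}"
    using p0 by (simp add: degree_prod_sum_eq)
  finally have "card (UNIV :: 'n set) = card {z. poly p z = 0}" using assms(1) by simp
  then obtain d :: "'n \<Rightarrow> complex" where "bij_betw d UNIV {z. poly p z = 0}"
    using finite_same_card_bij[of "UNIV :: 'n set"] poly_roots_finite[OF p0] by auto
  then show thesis by (intro that[of d]) (auto simp: bij_betw_def)
qed

lemma exists_kernel_vector:
  fixes A :: "complex^'n^'n"
  assumes "Determinants.det A = 0"
  obtains v where "v \<noteq> 0" "A *v v = 0"
proof -
  have "\<not> inj ((*v) A)"
    using assms det_nz_iff_inj_gen[OF matrix_vector_mul_linear_gen, of A] by simp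
  then obtain x y where "A *v x = A *v y" "x \<noteq> y" by (auto simp: inj_def)
  then show thesis by (intro that[of "x - y"]) (auto simp: matrix_vector_mult_diff_distrib)
qed

lemma diagonal_mult_nth: "(diagonal d ** A) $ i $ j = d i * A $ i $ j"
  unfolding matrix_matrix_mult_def vec_lambda_beta
  by (subst sum.mono_neutral_right[of _ "{i}"]) auto

lemma mult_diagonal_nth: "(A ** diagonal d) $ i $ j = A $ i $ j * d j"
  unfolding matrix_matrix_mult_def vec_lambda_beta
  by (subst sum.mono_neutral_right[of _ "{j}"]) auto

lemma transpose_diagonal: "Finite_Cartesian_Product.transpose (diagonal d) = diagonal d"
  by (auto simp: transpose_def Finite_Cartesian_Product.vec_eq_iff)

text \<open>The kernel of \<open>V\<close> is invariant under the diagonal matrix \<open>d\<close>, hence spanned by coordinate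
  vectors as the \<open>d i\<close> are distinct; but no column of \<open>V\<close> vanishes.\<close>

lemma det_eigenvectors_nonzero:
  fixes V :: "complex^'n^'n"
  assumes d: "inj d" and a: "Determinants.det a \<noteq> 0"
    and V: "b ** V = a ** V ** diagonal d" and col: "\<And>i. column i V \<noteq> 0"
  shows "Determinants.det V \<noteq> 0"
proof
  assume "Determinants.det V = 0"
  then obtain c where c: "c \<noteq> 0" "V *v c = 0" by (rule exists_kernel_vector)
  then obtain i where i: "c $ i \<noteq> 0" by (auto simp: Finite_Cartesian_Product.vec_eq_iff)
  have inj_a: "x = 0" if "a *v x = 0" for x
    using that a by (metis invertible_det_nz matrix_left_invertible_ker invertible_left_inverse)
  have inv: "V *v (diagonal d *v x) = 0" if "V *v x = 0" for x
  proof -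
    have "a *v (V *v (diagonal d *v x)) = b *v (V *v x)"
      by (simp add: matrix_vector_mul_assoc V matrix_mul_assoc)
    then show ?thesis using that inj_a by simp
  qed
  have diag_v: "(diagonal e *v x) $ k = e k * x $ k" for e and x :: "complex^'n" and k
    unfolding matrix_vector_mult_def vec_lambda_beta
    by (subst sum.mono_neutral_right[of _ "{k}"]) auto
  \<comment> \<open>The factors D - d j, with D the diagonal matrix, are applied one by one to the
    kernel vector \<open>c\<close>. For \<open>S = UNIV - {i}\<close> only coordinate
    \<open>i\<close> survives, and it is non-zero.\<close>
  have "V *v (\<chi> k. (\<Prod>j\<in>S. d k - d j) * c $ k) = 0" if "finite S" for S
    using that
  proof (induction S rule: finite_induct)
    case empty
    then show ?case using c(2) by (simp add: vec_lambda_eta)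
  next
    case (insert j S)
    let ?x = "\<chi> k. (\<Prod>j\<in>S. d k - d j) * c $ k"
    have "(\<chi> k. (\<Prod>j\<in>insert j S. d k - d j) * c $ k) = diagonal d *v ?x - d j *s ?x"
      using insert.hyps by (simp add: Finite_Cartesian_Product.vec_eq_iff diag_v algebra_simps)
    then show ?case
      using insert.IH inv[of ?x] by (simp add: matrix_vector_mult_diff_distrib vec.scale)
  qed
  from this[of "UNIV - {i}"] have 0: "V *v (\<chi> k. (\<Prod>j\<in>UNIV - {i}. d k - d j) * c $ k) = 0" by simp
  define q where "q = (\<Prod>j\<in>UNIV - {i}. d i - d j) * c $ i"
  have q: "q \<noteq> 0" using i d by (auto simp: q_def inj_eq)
  have "(\<chi> k. (\<Prod>j\<in>UNIV - {i}. d k - d j) * c $ k) = (\<chi> k. if k = i then q else 0)"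
    by (auto simp: Finite_Cartesian_Product.vec_eq_iff q_def)
  with 0 have "V *v (\<chi> k. if k = i then q else 0) = 0" by simp
  moreover have "(V *v (\<chi> k. if k = i then q else 0)) $ l = V $ l $ i * q" for l
    unfolding matrix_vector_mult_def vec_lambda_beta
    by (subst sum.mono_neutral_right[of _ "{i}"]) auto
  ultimately have "V $ l $ i * q = 0" for l by simp
  then show False using q col[of i] by (auto simp: column_def Finite_Cartesian_Product.vec_eq_iff)
qed

text \<open>Each root \<open>d i\<close> gives a vector in the kernel of d i * a - b. The matrix
  with these columns is invertible and makes both forms diagonal; complex square roots then
  normalize \<open>a\<close> to the identity.\<close>

lemma simultaneous_diagonalization:
  fixes a b :: "complex^'n^'n"
  assumes sym: "a \<in> symmetric_forms" "b \<in> symmetric_forms" and gen: "generic_poly (a, b) \<noteq> 0"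
  obtains P :: "complex^'n^'n" and d where "invertible P" "inj d"
    "a = P ** Finite_Cartesian_Product.transpose P"
    "b = P ** diagonal d ** Finite_Cartesian_Product.transpose P"
proof -
  let ?T = Finite_Cartesian_Product.transpose
  have sa: "?T a = a" and sb: "?T b = b" using sym by (auto simp: symmetric_forms_def)
  have a: "Determinants.det a \<noteq> 0" using gen by (auto simp: generic_poly_def)
  then obtain d :: "'n \<Rightarrow> complex" where d: "inj d" "\<And>i. poly (pencil_poly a b) (d i) = 0"
    using exists_inj_roots[where 'n = 'n, of "pencil_poly a b"] gen
    by (auto simp: generic_poly_eq_resultant)
  have "\<exists>v. v \<noteq> 0 \<and> (mat_scale (d i) a - b) *v v = 0" for i
    using exists_kernel_vector[of "mat_scale (d i) a - b"] d(2)[of i] by (auto simp: poly_pencil_poly)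
  then obtain v where v: "\<And>i. v i \<noteq> 0" "\<And>i. (mat_scale (d i) a - b) *v v i = 0" by metis
  have bv: "b *v v i = d i *s (a *v v i)" for i
  proof -
    have "mat_scale (d i) a *v v i = d i *s (a *v v i)"
      by (simp add: Finite_Cartesian_Product.vec_eq_iff matrix_vector_mult_def mat_scale_def
          sum_distrib_left mult.assoc)
    then show ?thesis using v(2)[of i] by (simp add: matrix_vector_mult_diff_rdistrib)
  qed
  define V where "V = (\<chi> k i. v i $ k)"
  have mV: "(A ** V) $ k $ i = (A *v v i) $ k" for A k i
    by (simp add: matrix_matrix_mult_def matrix_vector_mult_def V_def)
  have bV: "b ** V = a ** V ** diagonal d"
    by (simp add: Finite_Cartesian_Product.vec_eq_iff mV mult_diagonal_nth bv mult.commute)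
  have col: "column i V = v i" for i by (simp add: column_def V_def vec_lambda_eta)
  have V: "Determinants.det V \<noteq> 0"
    using v(1) by (intro det_eigenvectors_nonzero[OF d(1) a bV]) (simp add: col)
  define G where "G = ?T V ** a ** V"
  have TG: "?T G = G"
    by (simp add: G_def matrix_transpose_mul sa matrix_mul_assoc)
  have Gb: "?T V ** b ** V = G ** diagonal d"
    by (simp add: G_def bV matrix_mul_assoc[symmetric])
  \<comment> \<open>Since \<open>b\<close> is symmetric, so is \<open>G ** diagonal d\<close>;
    transposing it shows that \<open>G\<close> commutes with \<open>diagonal d\<close>, and distinct
    \<open>d i\<close> then force the off-diagonal entries of \<open>G\<close> to vanish.\<close>
  have "?T (?T V ** b ** V) = ?T V ** b ** V"
    by (simp add: matrix_transpose_mul sb matrix_mul_assoc)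
  then have "G ** diagonal d = diagonal d ** G"
    unfolding Gb by (simp add: matrix_transpose_mul transpose_diagonal TG)
  then have "G $ i $ j * d j = d i * G $ i $ j" for i j
    by (metis diagonal_mult_nth mult_diagonal_nth)
  then have "G $ i $ j * (d j - d i) = 0" for i j by (simp add: algebra_simps)
  then have G0: "G $ i $ j = 0" if "i \<noteq> j" for i j
    using that d(1) by (metis eq_iff_diff_eq_0 injD mult_eq_0_iff)
  define g where "g i = G $ i $ i" for i
  have G: "G = diagonal g"
    using G0 by (auto simp: Finite_Cartesian_Product.vec_eq_iff g_def)
  have "Determinants.det G \<noteq> 0" using a V by (simp add: G_def Determinants.det_mul)
  moreover have "Determinants.det G = (\<Prod>i\<in>UNIV. g i)"
    unfolding G by (subst Determinants.det_diagonal) auto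
  ultimately have g: "g i \<noteq> 0" for i by (auto simp: prod_zero_iff)
  define h where "h i = 1 / csqrt (g i)" for i
  have h: "h i * g i * h i = 1" for i
    using g[of i] power2_csqrt[of "g i"] by (simp add: h_def field_simps power2_eq_square)
  define W where "W = V ** diagonal h"
  have WaW: "?T W ** a ** W = Finite_Cartesian_Product.mat 1"
  proof -
    have "?T W ** a ** W = diagonal h ** G ** diagonal h"
      by (simp add: W_def G_def matrix_transpose_mul transpose_diagonal matrix_mul_assoc)
    then show ?thesis
      using h by (auto simp: G Finite_Cartesian_Product.vec_eq_iff mult_diagonal_nth diagonal_mult_nth Finite_Cartesian_Product.mat_def)
  qed
  have WbW: "?T W ** b ** W = diagonal d"
  proof -
    have "?T W ** b ** W = diagonal h ** (?T V ** b ** V) ** diagonal h"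
      by (simp add: W_def matrix_transpose_mul transpose_diagonal matrix_mul_assoc)
    also have "\<dots> = diagonal h ** (diagonal g ** diagonal d) ** diagonal h"
      by (simp only: Gb G)
    finally show ?thesis
      using h by (auto simp: Finite_Cartesian_Product.vec_eq_iff mult_diagonal_nth diagonal_mult_nth algebra_simps)
  qed
  have "Determinants.det (?T W ** a ** W) = 1" by (simp add: WaW)
  then have "invertible W" by (auto simp: Determinants.det_mul invertible_det_nz)
  then obtain R where R: "W ** R = Finite_Cartesian_Product.mat 1" "R ** W = Finite_Cartesian_Product.mat 1"
    by (auto simp: invertible_def)
  have TR: "?T R ** ?T W = Finite_Cartesian_Product.mat 1"
    using arg_cong[OF R(1), of ?T] by (simp add: matrix_transpose_mul transpose_mat)
  have TR': "?T W ** ?T R = Finite_Cartesian_Product.mat 1"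
    using arg_cong[OF R(2), of ?T] by (simp add: matrix_transpose_mul transpose_mat)
  have conj: "?T R ** (?T W ** x ** W) ** R = x" for x
  proof -
    have "?T R ** (?T W ** x ** W) ** R = (?T R ** ?T W) ** x ** (W ** R)"
      by (simp only: matrix_mul_assoc)
    then show ?thesis by (simp add: TR R)
  qed
  \<comment> \<open>From W^T a W = I and W^T b W = diag d, the required congruence is by the inverse
    transpose of \<open>W\<close>, which is \<open>?T R\<close>.\<close>
  show thesis
  proof (rule that[of "?T R" d])
    show "invertible (?T R)" using TR TR' by (auto simp: invertible_def)
    show "a = ?T R ** ?T (?T R)" using conj[of a] by (simp add: WaW)
    show "b = ?T R ** diagonal d ** ?T (?T R)" using conj[of b] by (simp add: WbW)
  qed fact
qed

section \<open>Transport along congruence and conclusion\<close>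

text \<open>The action is equivariant: with R = P^-1, acting by P X R on P Q P^T gives P (X Q + Q
  X^T) P^T. Conjugation preserves the trace and congruence preserves symmetry, so both maps are
  bijections of the spaces involved.\<close>

lemma has_blocks_congruence_action_transport:
  fixes P :: "complex^'n^'n"
  assumes "invertible P"
    and bl: "has_blocks mat_scale (sl :: (complex^'n^'n) set) mat_scale symmetric_forms
      (\<lambda>X. congruence_action X a) (\<lambda>X. congruence_action X b) bs"
  shows "has_blocks mat_scale (sl :: (complex^'n^'n) set) mat_scale symmetric_forms
      (\<lambda>X. congruence_action X (P ** a ** Finite_Cartesian_Product.transpose P))
      (\<lambda>X. congruence_action X (P ** b ** Finite_Cartesian_Product.transpose P)) bs"
proof -
  let ?T = Finite_Cartesian_Product.transpose and ?I = "Finite_Cartesian_Product.mat 1 :: complex^'n^'n"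
  obtain R where R: "P ** R = ?I" "R ** P = ?I" using assms(1) by (auto simp: invertible_def)
  have TR: "?T R ** ?T P = ?I" "?T P ** ?T R = ?I"
    using arg_cong[OF R(1), of ?T] arg_cong[OF R(2), of ?T] by (simp_all add: matrix_transpose_mul transpose_mat)
  have lin: "Vector_Spaces.linear mat_scale mat_scale (\<lambda>X :: complex^'n^'n. M ** X ** N)" for M N :: "complex^'n^'n"
    by (simp add: Vector_Spaces.linear_iff vector_space_mat_scale matrix_add_ldistrib matrix_distribs)
      (simp add: mat_scale_def matrix_matrix_mult_def Finite_Cartesian_Product.vec_eq_iff
        sum_distrib_left sum_distrib_right mult.assoc mult.left_commute)
  have cancel: "M' ** (M ** X ** N) ** N' = X" if "M' ** M = ?I" "N ** N' = ?I" for M M' N N' X :: "complex^'n^'n"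
  proof -
    have "M' ** (M ** X ** N) ** N' = (M' ** M) ** X ** (N ** N')" by (simp only: matrix_mul_assoc)
    then show ?thesis by (simp add: that)
  qed
  have sl: "M ** X ** N \<in> sl" if "X \<in> sl" "N ** M = ?I" for X M N :: "complex^'n^'n"
  proof -
    have "Determinants.trace (M ** X ** N) = Determinants.trace ((N ** M) ** X)"
      by (subst Determinants.trace_mul_sym) (simp add: matrix_mul_assoc)
    then show ?thesis using that by (simp add: sl_def)
  qed
  have symm: "M ** X ** ?T M \<in> symmetric_forms" if "X \<in> symmetric_forms" for X M :: "complex^'n^'n"
    using that by (simp add: symmetric_forms_def matrix_transpose_mul matrix_mul_assoc)
  have bij_sl: "inj_on (\<lambda>X. P ** X ** R) sl" "(\<lambda>X. P ** X ** R) ` sl = sl"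
  proof -
    show "inj_on (\<lambda>X. P ** X ** R) sl"
      by (rule inj_on_inverseI[where g = "\<lambda>X. R ** X ** P"]) (simp add: cancel R)
    have "X \<in> (\<lambda>X. P ** X ** R) ` sl" if "X \<in> sl" for X
      using that by (intro image_eqI[where x = "R ** X ** P"]) (simp_all add: cancel R sl)
    then show "(\<lambda>X. P ** X ** R) ` sl = sl" using R by (auto intro: sl)
  qed
  have bij_sym: "inj_on (\<lambda>X. P ** X ** ?T P) symmetric_forms"
    "(\<lambda>X. P ** X ** ?T P) ` symmetric_forms = symmetric_forms"
  proof -
    show "inj_on (\<lambda>X. P ** X ** ?T P) symmetric_forms"
      by (rule inj_on_inverseI[where g = "\<lambda>X. R ** X ** ?T R"]) (simp add: cancel R TR)
    have "X \<in> (\<lambda>X. P ** X ** ?T P) ` symmetric_forms" if "X \<in> symmetric_forms" for X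
      using that by (intro image_eqI[where x = "R ** X ** ?T R"]) (simp_all add: cancel R TR symm)
    then show "(\<lambda>X. P ** X ** ?T P) ` symmetric_forms = symmetric_forms" by (auto intro: symm)
  qed
  have equiv: "congruence_action (P ** X ** R) (P ** Q ** ?T P) = P ** congruence_action X Q ** ?T P" for X Q
  proof -
    have "P ** X ** R ** (P ** Q ** ?T P) = P ** X ** (R ** P) ** Q ** ?T P"
      by (simp only: matrix_mul_assoc)
    moreover have "P ** Q ** ?T P ** ?T (P ** X ** R) = P ** Q ** (?T P ** ?T R) ** ?T X ** ?T P"
      by (simp only: matrix_mul_assoc matrix_transpose_mul)
    ultimately show ?thesis
      by (simp add: congruence_action_def R TR matrix_add_ldistrib matrix_distribs matrix_mul_assoc)
  qed
  show ?thesis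
    by (rule has_blocks_transport[OF lin bij_sl lin bij_sym equiv equiv bl])
qed

lemma type_of_blocks_replicate_horizontal_vertical:
  "type_of_blocks (replicate m (Horizontal h) @ [Vertical v]) =
    \<lparr> jordan_sizes = {#}, horizontal_indices = replicate_mset m h, vertical_indices = {#v#} \<rparr>"
proof -
  have "{\<mu>. \<exists>k. Jordan \<mu> k \<in> set (replicate m (Horizontal h) @ [Vertical v])} = {}" by auto
  moreover have "concat (map (\<lambda>b. case b of Horizontal h \<Rightarrow> [h] | _ \<Rightarrow> []) (replicate m (Horizontal h))) = replicate m h"
    by (induction m) auto
  moreover have "concat (map (\<lambda>b. case b of Vertical h \<Rightarrow> [h] | _ \<Rightarrow> []) (replicate m (Horizontal h))) = []"
    by (induction m) auto
  ultimately show ?thesis by (simp add: type_of_blocks_def)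
qed

theorem theorem4p7:
  assumes "CARD('n::finite) > 1"
  shows "has_JK_invariants mat_scale (sl :: (complex^'n^'n) set)
           mat_scale (symmetric_forms :: (complex^'n^'n) set) congruence_action
           \<lparr> jordan_sizes = {#},
             horizontal_indices = replicate_mset (CARD('n) * (CARD('n) - 1) div 2) 2,
             vertical_indices = {#CARD('n)#} \<rparr>"
proof -
  let ?W = "symmetric_forms :: (complex^'n^'n) set"
  let ?bs = "replicate (CARD('n) * (CARD('n) - 1) div 2) (Horizontal 2) @ [Vertical CARD('n)]"
  \<comment> \<open>The generic set is the principal open set of a single polynomial.\<close>
  define \<Omega> where "\<Omega> = {x \<in> ?W \<times> ?W. generic_poly x \<noteq> 0}"
  have "zariski_open_in (module_prod.scale mat_scale mat_scale) (?W \<times> ?W) \<Omega>"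
    unfolding zariski_open_in_def \<Omega>_def
    using generic_poly_polynomial_fun by (intro exI[of _ "{generic_poly}"]) auto
  moreover have "\<Omega> \<noteq> {}"
  proof -
    \<comment> \<open>Distinct natural numbers, embedded in the complex numbers, serve as the
      diagonal entries of the witness.\<close>
    obtain f :: "'n \<Rightarrow> nat" where "inj f"
      using finite_imp_inj_to_nat_seg[of "UNIV :: 'n set"] by auto
    then have "inj (\<lambda>i. of_nat (f i) :: complex)" by (simp add: inj_def)
    then have "(diagonal (\<lambda>_. 1), diagonal (\<lambda>i. of_nat (f i))) \<in> \<Omega>"
      by (simp add: \<Omega>_def generic_poly_diagonal_nonzero symmetric_forms_def transpose_diagonal)
    then show ?thesis by blast
  qed
  moreover have "has_algebraic_type mat_scale sl mat_scale ?W (\<lambda>X. congruence_action X a)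
      (\<lambda>X. congruence_action X b) (type_of_blocks ?bs)" if ab: "(a, b) \<in> \<Omega>" for a b
  proof -
    have "a \<in> ?W" "b \<in> ?W" "generic_poly (a, b) \<noteq> 0" using ab by (auto simp: \<Omega>_def)
    then obtain P :: "complex^'n^'n" and d where P: "invertible P" "inj d"
      "a = P ** Finite_Cartesian_Product.transpose P"
      "b = P ** diagonal d ** Finite_Cartesian_Product.transpose P"
      by (rule simultaneous_diagonalization)
    have "diagonal (\<lambda>_. 1) = (Finite_Cartesian_Product.mat 1 :: complex^'n^'n)"
      by (simp add: Finite_Cartesian_Product.vec_eq_iff Finite_Cartesian_Product.mat_def)
    then have "a = P ** diagonal (\<lambda>_. 1) ** Finite_Cartesian_Product.transpose P" using P(3) by simp
    then have "has_blocks mat_scale sl mat_scale ?W (\<lambda>X. congruence_action X a)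
        (\<lambda>X. congruence_action X b) ?bs"
      using has_blocks_congruence_action_transport[OF P(1) has_blocks_congruence_action_diagonal[OF P(2)]] P(4)
      by simp
    then show ?thesis unfolding has_blocks_def has_algebraic_type_def by blast
  qed
  ultimately show ?thesis
    unfolding has_JK_invariants_def type_of_blocks_replicate_horizontal_vertical[symmetric] by blast
qed

end
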